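(* Let $\mathbf{k}=(k_1,\ldots,k_r)\in\mathbb{Z}_{\ge1}^r$ and $m\in\mathbb{Z}_{\ge1}$. Put $\mathbf{k}_+=(k_1,\ldots,k_{r-1},k_r+1)$ and let $n=d((\mathbf{k}_+)^* )=k_1+\cdots+k_r+1-r$. Then \[\xi(k_1,\ldots,k_r;m)=\sum_{\mathbf{j}\in\mathbb{Z}_{\ge0}^n,\ |\mathbf{j}|=m-1} b((\mathbf{k}_+)^*;\mathbf{j})\,\zeta((\mathbf{k}_+)^*+\mathbf{j})\] and \[\eta(k_1,\ldots,k_r;m)=(-1)^{r-1}\sum_{\mathbf{j}\in\mathbb{Z}_{\ge0}^n,\ |\mathbf{j}|=m-1} b((\mathbf{k}_+)^*;\mathbf{j})\,\zeta^\star((\mathbf{k}_+)^*+\mathbf{j}).\] In particular $\xi(k_1,\ldots,k_r;1)=\zeta((\mathbf{k}_+)^* )$ and $\eta(k_1,\ldots,k_r;1)=(-1)^{r-1}\zeta^\star((\mathbf{k}_+)^* )$.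
   Context: For positive integers $k_1,\ldots,k_r$, $\mathrm{Li}_{k_1,\ldots,k_r}(z)=\sum_{1\le m_1<\cdots<m_r} z^{m_r}/(m_1^{k_1}\cdots m_r^{k_r})$ for $|z|<1$, extended to a holomorphic function on $\mathbb{C}\setminus[1,\infty)$ by analytic continuation. For $\mathrm{Re}(s)>1-r$, $\xi(k_1,\ldots,k_r;s)=\frac{1}{\Gamma(s)}\int_0^\infty t^{s-1}\frac{\mathrm{Li}_{k_1,\ldots,k_r}(1-e^{-t})}{e^t-1}dt$ and $\eta(k_1,\ldots,k_r;s)=\frac{1}{\Gamma(s)}\int_0^\infty t^{s-1}\frac{\mathrm{Li}_{k_1,\ldots,k_r}(1-e^{t})}{1-e^t}dt$. Multiple zeta values: $\zeta(l_1,\ldots,l_r)=\sum_{1\le m_1<\cdots<m_r}\frac{1}{m_1^{l_1}\cdots m_r^{l_r}}$ and multiple zeta-star values $\zeta^\star(l_1,\ldots,l_r)=\sum_{1\le m_1\le\cdots\le m_r}\frac{1}{m_1^{l_1}\cdots m_r^{l_r}}$, for $l_i\ge1$, $l_r\ge2$. An index $(l_1,\ldots,l_r)$ of positive integers is admissible if $l_r\ge2$. Every admissible index can be uniquely written as $(\{1\}^{a_1-1},b_1+1,\{1\}^{a_2-1},b_2+1,\ldots,\{1\}^{a_h-1},b_h+1)$ with $h\ge1$, $a_i\ge1$, $b_i\ge1$, where $\{1\}^c$ denotes $c$ consecutive ones; its dual index is $(\{1\}^{b_h-1},a_h+1,\{1\}^{b_{h-1}-1},a_{h-1}+1,\ldots,\{1\}^{b_1-1},a_1+1)$,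 denoted by a superscript $*$. For $\mathbf{j}=(j_1,\ldots,j_n)\in\mathbb{Z}_{\ge0}^n$, $|\mathbf{j}|=j_1+\cdots+j_n$, $d(\mathbf{j})=n$; for $\mathbf{l}=(l_1,\ldots,l_n)$ of the same depth, $\mathbf{l}+\mathbf{j}$ is componentwise addition and $b(\mathbf{l};\mathbf{j})=\prod_{i=1}^n\binom{l_i+j_i-1}{j_i}$. *)

theory Defs
  imports "HOL-Complex_Analysis.Complex_Analysis"
begin

text \<open>An index \<open>(k\<^sub>1, \<dots>, k\<^sub>r)\<close> is a list of natural numbers; positivity of its entries is
  assumed where needed. Note that \<open>ks ! i\<close> is \<open>k\<^sub>i\<^sub>+\<^sub>1\<close>.\<close>

definition increasing_tuples :: "nat \<Rightarrow> nat list set" where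
  "increasing_tuples r = {ms. length ms = r \<and> (\<forall>m\<in>set ms. 1 \<le> m) \<and> sorted_wrt (<) ms}"

definition weakly_increasing_tuples :: "nat \<Rightarrow> nat list set" where
  "weakly_increasing_tuples r = {ms. length ms = r \<and> (\<forall>m\<in>set ms. 1 \<le> m) \<and> sorted_wrt (\<le>) ms}"

definition mzv :: "nat list \<Rightarrow> real" where
  "mzv ls = (\<Sum>\<^sub>\<infinity>ms\<in>increasing_tuples (length ls). 1 / (\<Prod>i<length ls. real (ms ! i) ^ (ls ! i)))"

definition mzv_star :: "nat list \<Rightarrow> real" where
  "mzv_star ls =
     (\<Sum>\<^sub>\<infinity>ms\<in>weakly_increasing_tuples (length ls). 1 / (\<Prod>i<length ls. real (ms ! i) ^ (ls ! i)))"

definition Li_series :: "nat list \<Rightarrow> complex \<Rightarrow> complex" where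
  "Li_series ks z =
     (\<Sum>\<^sub>\<infinity>ms\<in>increasing_tuples (length ks). z ^ last ms / (\<Prod>i<length ks. of_nat (ms ! i) ^ (ks ! i)))"

definition slit_plane :: "complex set" where
  "slit_plane = UNIV - complex_of_real ` {1..}"

text \<open>The analytic continuation of the series to \<open>slit_plane\<close>. Since \<open>slit_plane\<close> is open and
  connected and contains the unit disc, the two conditions determine the values there;
  values on the cut are irrelevant.\<close>

definition Li :: "nat list \<Rightarrow> complex \<Rightarrow> complex" where
  "Li ks = (SOME f. f holomorphic_on slit_plane \<and> (\<forall>z\<in>ball 0 1. f z = Li_series ks z))"

text \<open>The two zeta functions below are meant for \<open>Re s > 1 - r\<close>, where \<open>r\<close> is the depth of \<open>ks\<close>;
  the integrals converge absolutely there.\<close>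

definition AK_xi :: "nat list \<Rightarrow> complex \<Rightarrow> complex" where
  "AK_xi ks s = 1 / Gamma s *
     (LINT t:{0<..}|lborel. of_real t powr (s - 1) *
        (Li ks (of_real (1 - exp (- t))) / of_real (exp t - 1)))"

definition KT_eta :: "nat list \<Rightarrow> complex \<Rightarrow> complex" where
  "KT_eta ks s = 1 / Gamma s *
     (LINT t:{0<..}|lborel. of_real t powr (s - 1) *
        (Li ks (of_real (1 - exp t)) / of_real (1 - exp t)))"

definition index_plus :: "nat list \<Rightarrow> nat list" where
  "index_plus ks = butlast ks @ [last ks + 1]"

text \<open>The list \<open>[(a\<^sub>1, b\<^sub>1), \<dots>, (a\<^sub>h, b\<^sub>h)]\<close> encodes the index
  \<open>({1}\<^bsup>a\<^sub>1 - 1\<^esup>, b\<^sub>1 + 1, \<dots>, {1}\<^bsup>a\<^sub>h - 1\<^esup>, b\<^sub>h + 1)\<close>.\<close>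

definition index_of_blocks :: "(nat \<times> nat) list \<Rightarrow> nat list" where
  "index_of_blocks bs = concat (map (\<lambda>(a, b). replicate (a - 1) 1 @ [b + 1]) bs)"

definition blocks_of_index :: "nat list \<Rightarrow> (nat \<times> nat) list" where
  "blocks_of_index ls =
     (THE bs. bs \<noteq> [] \<and> (\<forall>(a, b)\<in>set bs. 1 \<le> a \<and> 1 \<le> b) \<and> index_of_blocks bs = ls)"

text \<open>Only meaningful for admissible indices, i.e. nonempty lists of positive numbers
  with last entry at least 2: these are the ones with a (unique) block decomposition.\<close>

definition dual_index :: "nat list \<Rightarrow> nat list" where
  "dual_index ls = index_of_blocks (rev (map (\<lambda>(a, b). (b, a)) (blocks_of_index ls)))"

definition weak_compositions :: "nat \<Rightarrow> nat \<Rightarrow> nat list set" where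
  "weak_compositions n w = {js. length js = n \<and> sum_list js = w}"

definition index_add :: "nat list \<Rightarrow> nat list \<Rightarrow> nat list" where
  "index_add ls js = map2 (+) ls js"

definition b_coeff :: "nat list \<Rightarrow> nat list \<Rightarrow> nat" where
  "b_coeff ls js = (\<Prod>i<length ls. (ls ! i + js ! i - 1) choose (js ! i))"

end

theory Submission
  imports Defs
begin

text \<open>Substitute \<open>z = 1 - e\<^bsup>-t\<^esup>\<close> (for \<open>\<xi>\<close>) or \<open>z = 1 - e\<^bsup>t\<^esup>\<close> (for \<open>\<eta>\<close>) in the iterated
  integral of \<open>Li\<close>: up to sign, \<open>dz / (1 - z)\<close> becomes \<open>dt\<close>, and \<open>dz / z\<close> becomes the sum of
  \<open>e\<^bsup>-nt\<^esup> dt\<close> over \<open>n \<ge> 1\<close> or \<open>n \<ge> 0\<close>, respectively. So the zeta value is an iterated integral over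
  \<open>0 < t\<^sub>1 < \<dots> < t\<^sub>w < t < \<infinity>\<close> with nonnegative integrand, and Tonelli lets us integrate the
  outermost variable first. The exponents then accumulate to \<open>M\<^sub>1 < M\<^sub>2 < \<dots>\<close> or
  \<open>M\<^sub>1 \<le> M\<^sub>2 \<le> \<dots>\<close>: a form \<open>dz / z\<close> opens a new variable \<open>M\<close>, and each integration
  multiplies the formal generating function of the factors \<open>t\<^bsup>i\<^esup> / i!\<close> by \<open>1 / (M - X)\<close>. Reading
  the word of \<open>k\<^sub>+\<close> from the top in this way produces exactly the dual index, and the binomial
  coefficients are those of \<open>(M - X)\<^bsup>-l\<^esup>\<close>.

  The parameter \<open>d\<close> is the least gap between consecutive summation variables:
  \<open>d = 1\<close> is the case of \<open>\<xi>\<close> and \<open>\<zeta>\<close>, \<open>d = 0\<close> that of \<open>\<eta>\<close> and \<open>\<zeta>\<^sup>\<star>\<close>.\<close>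

section \<open>Duality of indices\<close>

text \<open>\<open>True\<close> stands for the form \<open>dz / (1 - z)\<close> and \<open>False\<close> for \<open>dz / z\<close>; the innermost form
  comes first.\<close>

definition index_word :: "nat list \<Rightarrow> bool list" where
  "index_word ls = concat (map (\<lambda>l. True # replicate (l - 1) False) ls)"

text \<open>The effect of integrating out the outermost form on the index built so far.\<close>

definition index_step :: "nat list \<Rightarrow> bool \<Rightarrow> nat list" where
  "index_step ls a = (if a then butlast ls @ [Suc (last ls)] else ls @ [1])"

lemma index_word_simps [simp]:
  "index_word [] = []"
  "index_word (l # ls) = True # replicate (l - 1) False @ index_word ls"
  "index_word (ls @ ls') = index_word ls @ index_word ls'"
  by (simp_all add: index_word_def)

lemma foldl_index_step_True:
  "foldl index_step (ls @ [l]) (replicate i True) = ls @ [l + i]"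
  by (induction i arbitrary: l) (simp_all add: index_step_def)

text \<open>After complementation the leading letter of an entry \<open>l\<close> opens a new entry
  1 and each of its other \<open>l - 1\<close> letters raises it, so the fold inverts
  \<open>index_word\<close>.\<close>

lemma foldl_index_step_index_word:
  assumes "\<forall>l\<in>set ls. 1 \<le> l"
  shows "foldl index_step acc (map Not (index_word ls)) = acc @ ls"
  using assms
proof (induction ls arbitrary: acc)
  case (Cons l ls)
  have "foldl index_step acc (map Not (index_word (l # ls))) =
    foldl index_step (foldl index_step (acc @ [1]) (replicate (l - 1) True)) (map Not (index_word ls))"
    by (simp add: index_step_def)
  also have "\<dots> = acc @ (l # ls)"
    using Cons by (simp only: foldl_index_step_True) simp
  finally show ?case .
qed simp

section \<open>Block decompositions and the dual index\<close>

definition valid_blocks :: "(nat \<times> nat) list \<Rightarrow> bool" where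
  "valid_blocks bs \<longleftrightarrow> (\<forall>(a, b)\<in>set bs. 1 \<le> a \<and> 1 \<le> b)"

lemma index_of_blocks_Cons:
  "index_of_blocks ((a, b) # bs) = replicate (a - 1) 1 @ (b + 1) # index_of_blocks bs"
  by (simp add: index_of_blocks_def)

lemma index_of_blocks_Nil [simp]: "index_of_blocks [] = []"
  by (simp add: index_of_blocks_def)

lemma index_of_blocks_pos: "l \<in> set (index_of_blocks bs) \<Longrightarrow> 1 \<le> l"
  by (auto simp: index_of_blocks_def)

lemma last_index_of_blocks:
  "valid_blocks bs \<Longrightarrow> bs \<noteq> [] \<Longrightarrow> 2 \<le> last (index_of_blocks bs)"
  by (induction bs rule: rev_induct) (auto simp: index_of_blocks_def valid_blocks_def)

lemma replicate_1_append_inj: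
  fixes b b' :: nat
  assumes "replicate i 1 @ (b + 1) # xs = replicate i' 1 @ (b' + 1) # xs'" "1 \<le> b" "1 \<le> b'"
  shows "i = i' \<and> b = b' \<and> xs = xs'"
  using assms
proof (induction i arbitrary: i')
  case 0 then show ?case by (cases i') auto
next
  case (Suc i) then show ?case by (cases i') auto
qed

lemma index_of_blocks_inj:
  assumes "valid_blocks bs" "valid_blocks bs'" "index_of_blocks bs = index_of_blocks bs'"
  shows "bs = bs'"
  using assms
proof (induction bs arbitrary: bs')
  case Nil
  then show ?case by (cases bs') (auto simp: index_of_blocks_Cons)
next
  case (Cons p bs)
  obtain a b where p: "p = (a, b)" by force
  with Cons.prems obtain a' b' bs'' where bs': "bs' = (a', b') # bs''"
    by (cases bs') (auto simp: index_of_blocks_Cons)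
  have eq: "replicate (a - 1) 1 @ (b + 1) # index_of_blocks bs =
      replicate (a' - 1) 1 @ (b' + 1) # index_of_blocks bs''"
    using Cons.prems(3) unfolding p bs' index_of_blocks_Cons .
  have ge: "1 \<le> a" "1 \<le> b" "1 \<le> a'" "1 \<le> b'" and v: "valid_blocks bs" "valid_blocks bs''"
    using Cons.prems unfolding p bs' by (auto simp: valid_blocks_def)
  from replicate_1_append_inj[OF eq ge(2,4)] Cons.IH[OF v] ge show ?case
    by (auto simp: p bs')
qed

text \<open>Built from the front: an entry 1 lengthens the run of the first block, a larger entry
  \<open>l\<close> starts a block \<open>(1, l - 1)\<close>, and the last entry, being at least 2,
  supplies the initial block.\<close>

lemma index_of_blocks_surj:
  assumes "ls \<noteq> []" "\<forall>l\<in>set ls. 1 \<le> l" "2 \<le> last ls"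
  shows "\<exists>bs. bs \<noteq> [] \<and> valid_blocks bs \<and> index_of_blocks bs = ls"
  using assms
proof (induction ls)
  case (Cons l ls)
  show ?case
  proof (cases "ls = []")
    case True
    with Cons.prems show ?thesis
      by (intro exI[of _ "[(1, l - 1)]"]) (auto simp: valid_blocks_def index_of_blocks_def)
  next
    case False
    with Cons obtain a b bs where bs: "valid_blocks ((a, b) # bs)" "index_of_blocks ((a, b) # bs) = ls"
      by (auto simp: neq_Nil_conv)
    show ?thesis
    proof (cases "l = 1")
      case True
      have "replicate a (1::nat) = 1 # replicate (a - 1) 1"
        using bs(1) by (cases a) (auto simp: valid_blocks_def)
      with bs True show ?thesis
        by (intro exI[of _ "(a + 1, b) # bs"]) (auto simp: valid_blocks_def index_of_blocks_Cons)
    next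
      case False
      with bs Cons.prems show ?thesis
        by (intro exI[of _ "(1, l - 1) # (a, b) # bs"])
          (auto simp: valid_blocks_def index_of_blocks_Cons)
    qed
  qed
qed simp

lemma blocks_of_index_of_blocks:
  assumes "valid_blocks bs" "bs \<noteq> []"
  shows "blocks_of_index (index_of_blocks bs) = bs"
  unfolding blocks_of_index_def
  using assms index_of_blocks_inj by (intro the_equality) (auto simp: valid_blocks_def)

lemma index_word_index_of_blocks:
  assumes "valid_blocks bs"
  shows "index_word (index_of_blocks bs) =
    concat (map (\<lambda>(a, b). replicate a True @ replicate b False) bs)"
proof -
  have *: "index_word (replicate i (Suc 0)) = replicate i True" for i
    by (induction i) simp_all
  show ?thesis using assms
  proof (induction bs)
    case (Cons p bs)
    obtain a b where p: "p = (a, b)" by force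
    with Cons.prems obtain i where "a = Suc i" by (cases a) (auto simp: valid_blocks_def)
    with Cons show ?case
      by (simp add: p index_of_blocks_Cons * valid_blocks_def flip: replicate_append_same)
  qed simp
qed

text \<open>A block \<open>(a, b)\<close> contributes \<open>a\<close> letters \<open>True\<close>
  and then \<open>b\<close> letters \<open>False\<close>. Reversal with complementation swaps the
  two counts and reverses the order of the blocks; this is the classical symmetry z -> 1 - z of
  iterated integrals.\<close>

lemma index_word_dual_blocks:
  assumes "valid_blocks bs"
  shows "index_word (index_of_blocks (rev (map (\<lambda>(a, b). (b, a)) bs))) =
    map Not (rev (index_word (index_of_blocks bs)))"
proof -
  have "valid_blocks (rev (map (\<lambda>(a, b). (b, a)) bs))"
    using assms by (auto simp: valid_blocks_def)
  then show ?thesis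
    by (simp add: index_word_index_of_blocks assms rev_concat rev_map map_concat o_def
        case_prod_unfold)
qed

text \<open>Folding the complemented word of the dual recovers the dual, and that complemented word
  is the reversed word of \<open>ls\<close>.\<close>

lemma dual_index_props:
  assumes "ls \<noteq> []" "\<forall>l\<in>set ls. 1 \<le> l" "2 \<le> last ls"
  shows "dual_index ls = foldl index_step [] (rev (index_word ls))"
    and "\<forall>l\<in>set (dual_index ls). 1 \<le> l" and "dual_index ls \<noteq> []" and "2 \<le> last (dual_index ls)"
proof -
  from index_of_blocks_surj[OF assms] obtain bs
    where bs: "bs \<noteq> []" "valid_blocks bs" "ls = index_of_blocks bs" by blast
  define bs' where "bs' = rev (map (\<lambda>(a, b). (b, a)) bs)"
  have dual: "dual_index ls = index_of_blocks bs'"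
    by (simp add: dual_index_def bs blocks_of_index_of_blocks bs'_def)
  then show pos: "\<forall>l\<in>set (dual_index ls). 1 \<le> l"
    using index_of_blocks_pos by auto
  have bs': "bs' \<noteq> []" "valid_blocks bs'"
    using bs by (auto simp: bs'_def valid_blocks_def)
  then show "2 \<le> last (dual_index ls)" by (simp add: dual last_index_of_blocks)
  show "dual_index ls \<noteq> []"
    using bs' unfolding dual by (cases bs') (auto simp: index_of_blocks_Cons split: prod.splits)
  have "map Not (index_word (dual_index ls)) = rev (index_word ls)"
    unfolding dual bs'_def index_word_dual_blocks[OF bs(2)] by (simp add: bs(3) o_def)
  with foldl_index_step_index_word[OF pos, of "[]"]
  show "dual_index ls = foldl index_step [] (rev (index_word ls))" by simp
qed

text \<open>Raising the last entry appends one \<open>False\<close> to the word. Read from the top,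
  this letter comes first and opens the entry 1, whence the start value \<open>[1]\<close>; the rest
  of the fold sees only the word of \<open>ks\<close>.\<close>

lemma dual_index_plus:
  assumes "ks \<noteq> []" "\<forall>k\<in>set ks. 1 \<le> k"
  shows "dual_index (index_plus ks) = foldl index_step [1] (rev (index_word ks))"
    and "\<forall>l\<in>set (dual_index (index_plus ks)). 1 \<le> l" and "dual_index (index_plus ks) \<noteq> []"
    and "2 \<le> last (dual_index (index_plus ks))"
    and "length (dual_index (index_plus ks)) = sum_list ks + 1 - length ks"
proof -
  obtain ks' k where ks: "ks = ks' @ [k]" using assms(1) by (cases ks rule: rev_exhaust) auto
  have adm: "index_plus ks \<noteq> []" "\<forall>l\<in>set (index_plus ks). 1 \<le> l" "2 \<le> last (index_plus ks)"
    using assms(2) by (auto simp: index_plus_def ks)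
  note dual_index_props[OF adm]
  then show "\<forall>l\<in>set (dual_index (index_plus ks)). 1 \<le> l" "dual_index (index_plus ks) \<noteq> []"
    "2 \<le> last (dual_index (index_plus ks))" by blast+
  have "1 \<le> k" using assms(2) ks by auto
  then obtain i where "k = Suc i" by (cases k) auto
  then have "index_word (index_plus ks) = index_word ks @ [False]"
    by (simp add: index_plus_def ks replicate_append_same)
  then show eq: "dual_index (index_plus ks) = foldl index_step [1] (rev (index_word ks))"
    using dual_index_props(1)[OF adm] by (simp add: index_step_def)
  \<comment> \<open>Only \<open>False\<close> opens a new entry, and an entry \<open>k\<close> has
    \<open>k - 1\<close> such letters.\<close>
  have 1: "length (foldl index_step ls w) = length ls + length (filter Not w)" if "ls \<noteq> []" for ls w
    using that by (induction w arbitrary: ls) (auto simp: index_step_def)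
  have 2: "length (filter Not (index_word ks)) + length ks = sum_list ks"
    using assms(2) by (induction ks) auto
  show "length (dual_index (index_plus ks)) = sum_list ks + 1 - length ks"
    unfolding eq using 1[of "[1]" "rev (index_word ks)"] 2 by (simp add: rev_filter[symmetric])
qed

section \<open>Nested sums and their generating functions\<close>

text \<open>The largest summation variable is \<open>M\<close>. The value for the empty index acts as an additional
  variable \<open>M\<^sub>0 = 0\<close>; the term with \<open>M\<^sub>1 = 0\<close>, allowed by \<open>d = 0\<close>, vanishes because
  \<open>1 / 0 = 0\<close> and the exponents are positive.\<close>

definition nested_sum :: "nat \<Rightarrow> nat list \<Rightarrow> nat \<Rightarrow> real" where
  "nested_sum d ls = foldl (\<lambda>f l M. (\<Sum>M'<Suc M - d. f M') / real M ^ l) (\<lambda>M. if M = 0 then 1 else 0) ls"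

lemma nested_sum_Nil: "nested_sum d [] M = (if M = 0 then 1 else 0)"
  by (simp add: nested_sum_def)

lemma nested_sum_snoc: "nested_sum d (ls @ [l]) M = (\<Sum>M'<Suc M - d. nested_sum d ls M') / real M ^ l"
  by (simp add: nested_sum_def)

lemma nested_sum_nonneg: "0 \<le> nested_sum d ls M"
  by (induction ls arbitrary: M rule: rev_induct)
    (auto simp: nested_sum_Nil nested_sum_snoc intro!: divide_nonneg_nonneg sum_nonneg)

lemma nested_sum_0:
  assumes "ls \<noteq> []" "1 \<le> last ls"
  shows "nested_sum d ls 0 = 0"
  using assms by (cases ls rule: rev_exhaust) (auto simp: nested_sum_snoc)

section \<open>Tuples grouped by their largest entry\<close>

definition gap_tuples :: "nat \<Rightarrow> nat \<Rightarrow> nat list set" where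
  "gap_tuples d r = {ms. length ms = r \<and> (\<forall>m\<in>set ms. 1 \<le> m) \<and> sorted_wrt (\<lambda>x y. x + d \<le> y) ms}"

lemma increasing_tuples_eq: "increasing_tuples r = gap_tuples 1 r"
proof -
  have "(\<lambda>x y. x + 1 \<le> y) = ((<) :: nat \<Rightarrow> nat \<Rightarrow> bool)" by (auto simp: fun_eq_iff)
  then show ?thesis unfolding increasing_tuples_def gap_tuples_def by simp
qed

lemma weakly_increasing_tuples_eq: "weakly_increasing_tuples r = gap_tuples 0 r"
  by (simp add: weakly_increasing_tuples_def gap_tuples_def)

lemma gap_tuples_snoc:
  assumes "0 < r"
  shows "ms @ [m] \<in> gap_tuples d (Suc r) \<longleftrightarrow> ms \<in> gap_tuples d r \<and> 1 \<le> m \<and> last ms + d \<le> m"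
proof (cases ms rule: rev_exhaust)
  case Nil
  with assms show ?thesis by (auto simp: gap_tuples_def)
next
  case (snoc ms' m')
  show ?thesis by (auto simp: snoc gap_tuples_def sorted_wrt_append)
qed

abbreviation "gap_tuples_to d r M \<equiv> {ms \<in> gap_tuples d r. last ms = M}"

lemma gap_tuples_to_Suc:
  assumes "0 < r" "1 \<le> M"
  shows "gap_tuples_to d (Suc r) M = (\<Union>M'<Suc M - d. (\<lambda>ms. ms @ [M]) ` gap_tuples_to d r M')"
    (is "?L = ?R")
proof (intro set_eqI iffI)
  fix ms assume ms: "ms \<in> ?L"
  then obtain ms' where ms': "ms = ms' @ [M]"
    by (cases ms rule: rev_exhaust) (auto simp: gap_tuples_def)
  with ms gap_tuples_snoc[OF assms(1), of ms' M d] have "ms' \<in> gap_tuples d r" "last ms' < Suc M - d"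
    by auto
  with ms' show "ms \<in> ?R" by auto
next
  fix ms assume "ms \<in> ?R"
  then show "ms \<in> ?L" using gap_tuples_snoc[OF assms(1)] assms(2) by auto
qed

lemma gap_tuples_to_1: "gap_tuples_to d (Suc 0) M = (if 1 \<le> M then {[M]} else {})"
  by (auto simp: gap_tuples_def length_Suc_conv)

lemma gap_tuples_to_0: "0 < r \<Longrightarrow> gap_tuples_to d r 0 = {}"
  by (auto simp: gap_tuples_def dest!: last_in_set split: if_splits)

lemma finite_gap_tuples_to: "finite (gap_tuples_to d r M)"
proof (induction r arbitrary: M)
  case 0
  have "gap_tuples_to d 0 M \<subseteq> {[]}" by (auto simp: gap_tuples_def)
  then show ?case by (rule finite_subset) simp
next
  case (Suc r)
  show ?case
  proof (cases "r = 0 \<or> M = 0")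
    case True
    then show ?thesis
    proof
      assume "r = 0"
      then show ?thesis by (simp only: gap_tuples_to_1) simp
    next
      assume "M = 0"
      then show ?thesis by (simp only: gap_tuples_to_0[OF zero_less_Suc]) simp
    qed
  next
    case False
    then show ?thesis using gap_tuples_to_Suc[of r M d] Suc by auto
  qed
qed

definition tuple_weight :: "nat list \<Rightarrow> nat list \<Rightarrow> real" where
  "tuple_weight ls ms = 1 / (\<Prod>i<length ls. real (ms ! i) ^ (ls ! i))"

lemma tuple_weight_nonneg: "0 \<le> tuple_weight ls ms"
  by (auto simp: tuple_weight_def intro!: prod_nonneg)

lemma tuple_weight_snoc:
  assumes "length ms = length ls"
  shows "tuple_weight (ls @ [l]) (ms @ [m]) = tuple_weight ls ms / real m ^ l"
  using assms by (simp add: tuple_weight_def nth_append)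

lemma sum_tuple_weight:
  assumes "ls \<noteq> []" "\<forall>l\<in>set ls. 1 \<le> l" "d \<le> 1"
  shows "sum (tuple_weight ls) (gap_tuples_to d (length ls) M) = nested_sum d ls M"
  using assms(1,2)
proof (induction ls arbitrary: M rule: rev_induct)
  case (snoc l ls)
  consider "M = 0" | "M \<ge> 1" "ls = []" | "M \<ge> 1" "ls \<noteq> []" by linarith
  then show ?case
  proof cases
    case 1
    with snoc.prems show ?thesis by (subst 1, subst gap_tuples_to_0) (auto simp: nested_sum_0)
  next
    case 2
    \<comment> \<open>As \<open>M\<close> is positive and \<open>d\<close> is at most 1, the range
      contains 0, so the virtual variable M_0 = 0 contributes its value 1.\<close>
    have "(\<Sum>M'<Suc M - d. nested_sum d [] M') = 1"
      using assms(3) 2 by (simp add: nested_sum_Nil sum.delta)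
    with 2 show ?thesis
      using nested_sum_snoc[of d "[]" l M] gap_tuples_to_1[of d M] by (simp add: tuple_weight_def)
  next
    case 3
    let ?r = "length ls"
    have "sum (tuple_weight (ls @ [l])) (gap_tuples_to d (length (ls @ [l])) M) =
        (\<Sum>M'<Suc M - d. sum (tuple_weight (ls @ [l])) ((\<lambda>ms. ms @ [M]) ` gap_tuples_to d ?r M'))"
      unfolding length_append_singleton using 3
      by (subst gap_tuples_to_Suc, simp, simp, intro sum.UNION_disjoint)
        (use finite_gap_tuples_to in auto)
    also have "\<dots> = (\<Sum>M'<Suc M - d. sum (tuple_weight ls) (gap_tuples_to d ?r M') / real M ^ l)"
      by (intro sum.cong refl)
        (subst sum.reindex, auto simp: inj_on_def sum_divide_distrib gap_tuples_def
          intro!: sum.cong tuple_weight_snoc)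
    also have "\<dots> = nested_sum d (ls @ [l]) M"
      using snoc.IH snoc.prems 3 by (simp add: nested_sum_snoc sum_divide_distrib)
    finally show ?thesis .
  qed
qed simp

text \<open>Each fibre over the largest entry is finite, so unordered summation over tuples reduces
  to an absolutely convergent series in that entry. The factor \<open>u\<close> is constantly 1 for
  zeta values and \<open>z ^ M\<close> for polylogarithms.\<close>

lemma infsum_gap_tuples:
  fixes u :: "nat \<Rightarrow> 'a :: {banach, real_normed_field}"
  assumes "ls \<noteq> []" "\<forall>l\<in>set ls. 1 \<le> l" "d \<le> 1"
    and summ: "summable (\<lambda>M. norm (u M) * nested_sum d ls M)"
  shows "(\<Sum>\<^sub>\<infinity>ms\<in>gap_tuples d (length ls). u (last ms) * of_real (tuple_weight ls ms)) =
    (\<Sum>M. u M * of_real (nested_sum d ls M))"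
proof -
  let ?B = "gap_tuples_to d (length ls)"
  let ?f = "\<lambda>M ms. u M * of_real (tuple_weight ls ms) :: 'a"
  note hs = sum_tuple_weight[OF assms(1-3)]
  have norm_f: "norm (?f M ms) = norm (u M) * tuple_weight ls ms" for M ms
    by (simp add: norm_mult tuple_weight_nonneg)
  have "(\<lambda>M. norm (u M) * nested_sum d ls M) summable_on UNIV"
    using summ nested_sum_nonneg by (subst summable_on_UNIV_nonneg_real_iff) auto
  then have "(\<lambda>M. norm (\<Sum>\<^sub>\<infinity>ms\<in>?B M. norm (?f M ms))) summable_on UNIV"
    by (simp only: norm_f infsum_finite[OF finite_gap_tuples_to] hs nested_sum_nonneg
        flip: sum_distrib_left) (simp add: nested_sum_nonneg)
  then have "(\<lambda>p. norm (case p of (M, ms) \<Rightarrow> ?f M ms)) summable_on Sigma UNIV ?B"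
    using finite_gap_tuples_to by (subst Infinite_Sum.abs_summable_on_Sigma_iff) auto
  then have "(\<lambda>(M, ms). ?f M ms) summable_on Sigma UNIV ?B"
    by (rule abs_summable_summable)
  note Sig = infsum_Sigma'_banach[OF this]
  have bij: "bij_betw snd (Sigma UNIV ?B) (gap_tuples d (length ls))"
    by (auto simp: bij_betw_def inj_on_def image_iff)
  have "(\<Sum>\<^sub>\<infinity>ms\<in>gap_tuples d (length ls). u (last ms) * of_real (tuple_weight ls ms)) =
    (\<Sum>\<^sub>\<infinity>p\<in>Sigma UNIV ?B. u (last (snd p)) * of_real (tuple_weight ls (snd p)))"
    by (rule infsum_reindex_bij_betw[OF bij, symmetric])
  also have "\<dots> = infsum (\<lambda>(M, ms). ?f M ms) (Sigma UNIV ?B)"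
    by (intro infsum_cong) auto
  also have "\<dots> = (\<Sum>\<^sub>\<infinity>M\<in>UNIV. u M * of_real (nested_sum d ls M))"
    by (simp only: Sig[symmetric] infsum_finite[OF finite_gap_tuples_to] hs
        flip: sum_distrib_left of_real_sum)
  also have "\<dots> = (\<Sum>M. u M * of_real (nested_sum d ls M))"
  proof (rule infsumI, rule norm_summable_imp_has_sum)
    show *: "summable (\<lambda>M. norm (u M * of_real (nested_sum d ls M)))"
      using summ by (simp add: norm_mult nested_sum_nonneg)
    show "(\<lambda>M. u M * of_real (nested_sum d ls M)) sums (\<Sum>M. u M * of_real (nested_sum d ls M))"
      using summable_norm_cancel[OF *] by (rule summable_sums)
  qed
  finally show ?thesis .
qed

section \<open>Growth and convergence of nested sums\<close>

lemma sum_inverse_sqrt_le: "(\<Sum>M<N. 1 / sqrt (real (Suc M))) \<le> 2 * sqrt (real N)"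
proof (induction N)
  case (Suc N)
  let ?a = "sqrt (real N)" and ?b = "sqrt (real (Suc N))"
  have b: "0 < ?b" "?a \<le> ?b" "?b ^ 2 = ?a ^ 2 + 1" by auto
  have "1 = (?b - ?a) * (?b + ?a)" using b(3) by (simp add: algebra_simps power2_eq_square)
  also have "\<dots> \<le> (?b - ?a) * (2 * ?b)" using b by (intro mult_left_mono) auto
  finally have "1 / ?b \<le> 2 * (?b - ?a)" using b(1) by (simp add: field_simps)
  with Suc show ?case by simp
qed simp

text \<open>A square-root bound reproduces itself: division by at least M leaves a constant times
  M^(-1/2), whose sums are again of order M^(1/2) at the cost of a factor 2. Logarithmic bounds
  would be sharper, but this power is small enough for convergence.\<close>

lemma sum_nested_sum_le:
  assumes "\<forall>l\<in>set ls. 1 \<le> l" "1 \<le> M"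
  shows "(\<Sum>M'<Suc M - d. nested_sum d ls M') \<le> 2 ^ length ls * sqrt (real M)"
proof -
  have "(\<Sum>M'<Suc M. nested_sum d ls M') \<le> 2 ^ length ls * sqrt (real M)"
    using assms
  proof (induction ls arbitrary: M rule: rev_induct)
    case Nil
    then show ?case by (simp add: nested_sum_Nil sum.delta)
  next
    case (snoc l ls)
    have l: "1 \<le> l" and pos: "\<forall>l\<in>set ls. 1 \<le> l" using snoc.prems by auto
    have term_le: "nested_sum d (ls @ [l]) (Suc N) \<le> 2 ^ length ls * (1 / sqrt (real (Suc N)))" for N
    proof -
      let ?N = "real (Suc N)"
      have "(\<Sum>M'<Suc (Suc N) - d. nested_sum d ls M') \<le> (\<Sum>M'<Suc (Suc N). nested_sum d ls M')"
        by (intro sum_mono2) (auto simp: nested_sum_nonneg)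
      also have "\<dots> \<le> 2 ^ length ls * sqrt ?N"
        using snoc.IH[OF pos, of "Suc N"] by (simp del: sum.lessThan_Suc)
      finally have "nested_sum d (ls @ [l]) (Suc N) \<le> (2 ^ length ls * sqrt ?N) / ?N ^ l"
        unfolding nested_sum_snoc by (intro divide_right_mono) auto
      also have "\<dots> \<le> (2 ^ length ls * sqrt ?N) / ?N ^ 1"
        using power_increasing[of 1 l ?N] l by (intro divide_left_mono) auto
      also have "\<dots> = 2 ^ length ls * (1 / sqrt ?N)"
        by (simp add: sqrt_divide_self_eq inverse_eq_divide
            del: of_nat_Suc flip: times_divide_eq_right)
      finally show ?thesis .
    qed
    have "(\<Sum>M'<Suc M. nested_sum d (ls @ [l]) M') = (\<Sum>N<M. nested_sum d (ls @ [l]) (Suc N))"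
      using l by (subst sum.lessThan_Suc_shift) (simp add: nested_sum_0)
    also have "\<dots> \<le> (\<Sum>N<M. 2 ^ length ls * (1 / sqrt (real (Suc N))))"
      by (intro sum_mono term_le)
    also have "\<dots> \<le> 2 ^ length ls * (2 * sqrt (real M))"
      unfolding sum_distrib_left[symmetric] by (intro mult_left_mono sum_inverse_sqrt_le) auto
    finally show ?case by simp
  qed
  moreover have "(\<Sum>M'<Suc M - d. nested_sum d ls M') \<le> (\<Sum>M'<Suc M. nested_sum d ls M')"
    by (intro sum_mono2) (auto simp: nested_sum_nonneg)
  ultimately show ?thesis by linarith
qed

text \<open>Against the square-root growth of the inner sum, a last exponent of at least 2 leaves
  terms of order M^(-3/2).\<close>

lemma summable_nested_sum:
  assumes "ls \<noteq> []" "\<forall>l\<in>set ls. 1 \<le> l" "2 \<le> last ls"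
  shows "summable (nested_sum d ls)"
proof -
  obtain ls' l where ls: "ls = ls' @ [l]" using assms(1) by (cases ls rule: rev_exhaust) auto
  have l: "2 \<le> l" and pos: "\<forall>l\<in>set ls'. 1 \<le> l" using assms by (auto simp: ls)
  have "summable (\<lambda>M. 2 ^ length ls' * real M powr (-3/2))"
    by (intro summable_mult) (simp add: summable_real_powr_iff)
  moreover have "norm (nested_sum d ls M) \<le> 2 ^ length ls' * real M powr (-3/2)" if "1 \<le> M" for M
  proof -
    have "norm (nested_sum d ls M) = nested_sum d ls M" by (simp add: nested_sum_nonneg)
    also have "\<dots> \<le> (2 ^ length ls' * sqrt (real M)) / real M ^ l"
      unfolding ls nested_sum_snoc
      by (intro divide_right_mono sum_nested_sum_le pos that) auto
    also have "\<dots> \<le> (2 ^ length ls' * sqrt (real M)) / real M ^ 2"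
      using power_increasing[of 2 l "real M"] l that by (intro divide_left_mono) auto
    also have "sqrt (real M) / real M ^ 2 = real M powr (-3/2)"
      using that by (simp add: powr_half_sqrt[symmetric] powr_diff[symmetric] flip: powr_numeral)
    then have "(2 ^ length ls' * sqrt (real M)) / real M ^ 2 = 2 ^ length ls' * real M powr (-3/2)"
      by (simp flip: times_divide_eq_right)
    finally show ?thesis .
  qed
  ultimately show ?thesis by (rule summable_comparison_test'[where N = 1])
qed

lemma mzv_eq:
  assumes "ls \<noteq> []" "\<forall>l\<in>set ls. 1 \<le> l" "2 \<le> last ls"
  shows "mzv ls = (\<Sum>M. nested_sum 1 ls M)" and "mzv_star ls = (\<Sum>M. nested_sum 0 ls M)"
  using infsum_gap_tuples[OF assms(1,2), of 1 "\<lambda>_. 1 :: real"]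
    infsum_gap_tuples[OF assms(1,2), of 0 "\<lambda>_. 1 :: real"] summable_nested_sum[OF assms]
  by (simp_all add: mzv_def mzv_star_def increasing_tuples_eq weakly_increasing_tuples_eq
      tuple_weight_def)

text \<open>\<open>1 / (M - X)\<close>, but \<open>0\<close> for \<open>M = 0\<close>.\<close>

definition geom_fps :: "nat \<Rightarrow> real fps" where
  "geom_fps M = Abs_fps (\<lambda>s. 1 / real M ^ Suc s)"

lemma geom_fps_nth: "fps_nth (geom_fps M) s = 1 / real M ^ Suc s"
  by (simp add: geom_fps_def)

lemma geom_fps_0 [simp]: "geom_fps 0 = 0"
  by (simp add: geom_fps_def fps_eq_iff)

lemma geom_fps_inverse:
  assumes "1 \<le> M"
  shows "(fps_const (real M) - fps_X) * geom_fps M = 1"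
proof (rule fps_ext)
  fix s show "fps_nth ((fps_const (real M) - fps_X) * geom_fps M) s = fps_nth 1 s"
    using assms by (cases s) (simp_all add: geom_fps_def left_diff_distrib)
qed

text \<open>For positive \<open>M\<close> this is the negative binomial series of (M - X)^(-l); the
  induction convolves with a geometric series and uses the hockey-stick identity. At
  \<open>l = 0\<close>, truncated subtraction makes the binomial vanish for positive
  \<open>j\<close>.\<close>

lemma geom_fps_power_nth:
  "fps_nth (geom_fps M ^ l) j = real ((l + j - 1) choose j) / real M ^ (l + j)"
proof (induction l arbitrary: j)
  case (Suc l)
  have pascal: "(\<Sum>i=0..j. (l + i - 1) choose i) = (l + j) choose j"
    by (induction j) auto
  have "fps_nth (geom_fps M ^ Suc l) j =
    (\<Sum>i=0..j. real ((l + i - 1) choose i) / real M ^ (l + i) * (1 / real M ^ Suc (j - i)))"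
    by (simp only: power_Suc2 fps_mult_nth Suc geom_fps_nth)
  also have "\<dots> = (\<Sum>i=0..j. real ((l + i - 1) choose i) / real M ^ (Suc l + j))"
  proof (intro sum.cong refl)
    fix i assume "i \<in> {0..j}"
    then have "l + i + Suc (j - i) = Suc l + j" by simp
    then show "real ((l + i - 1) choose i) / real M ^ (l + i) * (1 / real M ^ Suc (j - i)) =
        real ((l + i - 1) choose i) / real M ^ (Suc l + j)"
      by (metis mult.right_neutral power_add times_divide_times_eq)
  qed
  also have "\<dots> = real (\<Sum>i=0..j. (l + i - 1) choose i) / real M ^ (Suc l + j)"
    by (simp add: sum_divide_distrib)
  finally show ?case unfolding pascal by simp
qed (auto simp: gr0_conv_Suc)

text \<open>The summation variables share one X, so the coefficient of X^s collects every way of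
  distributing s over the exponents.\<close>

definition nested_fps :: "nat \<Rightarrow> nat list \<Rightarrow> nat \<Rightarrow> real fps" where
  "nested_fps d ls =
    foldl (\<lambda>f l M. (\<Sum>M'<Suc M - d. f M') * geom_fps M ^ l) (\<lambda>M. if M = 0 then 1 else 0) ls"

lemma nested_fps_Nil: "nested_fps d [] M = (if M = 0 then 1 else 0)"
  by (simp add: nested_fps_def)

lemma nested_fps_snoc: "nested_fps d (ls @ [l]) M = (\<Sum>M'<Suc M - d. nested_fps d ls M') * geom_fps M ^ l"
  by (simp add: nested_fps_def)

lemma nested_fps_0:
  assumes "ls \<noteq> []" "1 \<le> last ls"
  shows "nested_fps d ls 0 = 0"
  using assms by (cases ls rule: rev_exhaust) (auto simp: nested_fps_snoc)

lemma finite_weak_compositions [simp]: "finite (weak_compositions n w)"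
proof -
  have "weak_compositions n w \<subseteq> {js. set js \<subseteq> {..w} \<and> length js = n}"
    by (auto simp: weak_compositions_def member_le_sum_list)
  then show ?thesis by (rule finite_subset) (rule finite_lists_length_eq, simp)
qed

lemma sum_weak_compositions_Suc:
  "sum f (weak_compositions (Suc n) w) = (\<Sum>i=0..w. \<Sum>js\<in>weak_compositions n i. f (js @ [w - i]))"
proof -
  have "bij_betw (\<lambda>(i, js). js @ [w - i]) (SIGMA i:{0..w}. weak_compositions n i)
      (weak_compositions (Suc n) w)"
  proof (rule bij_betw_byWitness[where f' = "\<lambda>js. (sum_list (butlast js), butlast js)"])
    have *: "butlast js @ [w - sum_list (butlast js)] = js \<and> sum_list (butlast js) \<le> w"
      if "js \<in> weak_compositions (Suc n) w" for js
      using that by (cases js rule: rev_exhaust) (auto simp: weak_compositions_def)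
    then show "\<forall>js\<in>weak_compositions (Suc n) w.
        (\<lambda>(i, js). js @ [w - i]) (sum_list (butlast js), butlast js) = js"
      by simp
    show "(\<lambda>js. (sum_list (butlast js), butlast js)) ` weak_compositions (Suc n) w
        \<subseteq> (SIGMA i:{0..w}. weak_compositions n i)"
      using * by (auto simp: weak_compositions_def)
  qed (auto simp: weak_compositions_def)
  from sum.reindex_bij_betw[OF this, of f, symmetric] show ?thesis
    by (simp add: sum.Sigma case_prod_unfold)
qed

text \<open>The Cauchy product with the last factor splits off the last part of a composition, and
  the negative binomial series supplies the last binomial of \<open>b_coeff\<close>.\<close>

lemma nested_fps_nth:
  "fps_nth (nested_fps d ls M) s =
    (\<Sum>js\<in>weak_compositions (length ls) s. real (b_coeff ls js) * nested_sum d (index_add ls js) M)"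
proof (induction ls arbitrary: M s rule: rev_induct)
  case Nil
  have "weak_compositions 0 s = (if s = 0 then {[]} else {})"
    by (auto simp: weak_compositions_def)
  then show ?case by (simp add: nested_fps_Nil b_coeff_def index_add_def nested_sum_Nil)
next
  case (snoc l ls)
  have b: "b_coeff (ls @ [l]) (js @ [j]) = b_coeff ls js * ((l + j - 1) choose j)"
    and a: "index_add (ls @ [l]) (js @ [j]) = index_add ls js @ [l + j]"
    if "js \<in> weak_compositions (length ls) i" for js i j
    using that by (simp_all add: b_coeff_def index_add_def weak_compositions_def nth_append)
  have "fps_nth (nested_fps d (ls @ [l]) M) s =
      (\<Sum>i=0..s. (\<Sum>M'<Suc M - d. \<Sum>js\<in>weak_compositions (length ls) i.
        real (b_coeff ls js) * nested_sum d (index_add ls js) M') *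
        (real ((l + (s - i) - 1) choose (s - i)) / real M ^ (l + (s - i))))"
    by (simp add: nested_fps_snoc fps_mult_nth fps_sum_nth geom_fps_power_nth snoc)
  also have "\<dots> = (\<Sum>i=0..s. \<Sum>js\<in>weak_compositions (length ls) i.
      real (b_coeff (ls @ [l]) (js @ [s - i])) * nested_sum d (index_add (ls @ [l]) (js @ [s - i])) M)"
  proof (intro sum.cong refl)
    fix i
    show "(\<Sum>M'<Suc M - d. \<Sum>js\<in>weak_compositions (length ls) i.
        real (b_coeff ls js) * nested_sum d (index_add ls js) M') *
        (real ((l + (s - i) - 1) choose (s - i)) / real M ^ (l + (s - i))) =
      (\<Sum>js\<in>weak_compositions (length ls) i.
        real (b_coeff (ls @ [l]) (js @ [s - i])) * nested_sum d (index_add (ls @ [l]) (js @ [s - i])) M)"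
      unfolding sum.swap[of _ "weak_compositions (length ls) i"] sum_distrib_right
      by (intro sum.cong refl)
        (simp add: a b nested_sum_snoc sum_distrib_left sum_divide_distrib mult_ac flip: sum_distrib_right)
  qed
  finally show ?case by (simp add: sum_weak_compositions_Suc)
qed

lemma nested_fps_nth_nonneg: "0 \<le> fps_nth (nested_fps d ls M) s"
  by (simp add: nested_fps_nth sum_nonneg nested_sum_nonneg)

text \<open>This turns the coefficient series into the right-hand side of the theorem. Adding
  \<open>js\<close> keeps the index admissible, so each of the finitely many inner series
  converges.\<close>

lemma nested_fps_index_sum:
  assumes "ls \<noteq> []" "\<forall>l\<in>set ls. 1 \<le> l" "2 \<le> last ls"
  shows "(\<lambda>M. fps_nth (nested_fps d ls M) s) sums
    (\<Sum>js\<in>weak_compositions (length ls) s. real (b_coeff ls js) * (\<Sum>M. nested_sum d (index_add ls js) M))"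
    and "js \<in> weak_compositions (length ls) s \<Longrightarrow>
      index_add ls js \<noteq> [] \<and> (\<forall>l\<in>set (index_add ls js). 1 \<le> l) \<and> 2 \<le> last (index_add ls js)"
proof -
  show adm: "index_add ls js \<noteq> [] \<and> (\<forall>l\<in>set (index_add ls js). 1 \<le> l) \<and> 2 \<le> last (index_add ls js)"
    if "js \<in> weak_compositions (length ls) s" for js
  proof -
    have len: "length (index_add ls js) = length ls"
      and nth: "i < length ls \<Longrightarrow> index_add ls js ! i = ls ! i + js ! i" for i
      using that by (auto simp: index_add_def weak_compositions_def)
    have "1 \<le> index_add ls js ! i" if "i < length ls" for i
      using assms(2) that by (simp add: nth trans_le_add1)
    moreover have "2 \<le> last (index_add ls js)"
      using assms(1,3) len nth[of "length ls - 1"]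
      by (cases "index_add ls js = []") (auto simp: last_conv_nth)
    ultimately show ?thesis using assms(1) len by (auto simp: in_set_conv_nth)
  qed
  show "(\<lambda>M. fps_nth (nested_fps d ls M) s) sums
    (\<Sum>js\<in>weak_compositions (length ls) s. real (b_coeff ls js) * (\<Sum>M. nested_sum d (index_add ls js) M))"
    unfolding nested_fps_nth using adm by (intro sums_sum sums_mult summable_sums summable_nested_sum) auto
qed

section \<open>Multiple polylogarithms on the slit plane\<close>

lemma slit_plane_eq: "slit_plane = - {z. Im z = 0 \<and> 1 \<le> Re z}"
  by (auto simp: slit_plane_def image_iff complex_eq_iff)

lemma open_slit_plane: "open slit_plane"
  unfolding slit_plane_eq
  by (intro open_Compl closed_Collect_conj closed_Collect_eq closed_Collect_le continuous_intros)

lemma of_real_in_slit_plane: "of_real x \<in> slit_plane \<longleftrightarrow> x < 1"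
  by (auto simp: slit_plane_eq)

lemma zero_in_slit_plane: "0 \<in> slit_plane"
  by (simp add: slit_plane_eq)

lemma ball_subset_slit_plane: "ball 0 1 \<subseteq> slit_plane"
proof
  fix z :: complex assume "z \<in> ball 0 1"
  then have "Re z < 1" using complex_Re_le_cmod[of z] by simp
  then show "z \<in> slit_plane" by (simp add: slit_plane_eq)
qed

lemma starlike_slit_plane: "starlike slit_plane"
  unfolding starlike_def
proof (intro bexI[of _ 0] ballI subsetI zero_in_slit_plane)
  fix z w assume z: "z \<in> slit_plane" and "w \<in> closed_segment 0 z"
  then obtain u where u: "0 \<le> u" "u \<le> 1" "w = u *\<^sub>R z" by (auto simp: in_segment)
  show "w \<in> slit_plane"
  proof (rule ccontr)
    assume "w \<notin> slit_plane"
    then have w: "u * Im z = 0" "1 \<le> u * Re z" by (auto simp: slit_plane_eq u)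
    then have "0 < u" using u(1) by (cases "u = 0") auto
    moreover have "0 < u * Re z" using w(2) by linarith
    ultimately have "0 < Re z" by (simp add: zero_less_mult_iff)
    then have "u * Re z \<le> 1 * Re z" using u by (intro mult_right_mono) auto
    then have "1 \<le> Re z" using w(2) by linarith
    with w(1) \<open>0 < u * Re z\<close> z show False by (simp add: slit_plane_eq)
  qed
qed

lemmas connected_slit_plane = starlike_imp_connected[OF starlike_slit_plane]

lemma has_fps_expansion_slit_plane_cong:
  assumes "f has_fps_expansion F" "\<And>z. z \<in> slit_plane \<Longrightarrow> f z = g z"
  shows "g has_fps_expansion F"
proof -
  have "eventually (\<lambda>z. f z = g z) (nhds 0)"
    using eventually_nhds_in_open[OF open_slit_plane zero_in_slit_plane]
    by eventually_elim (rule assms(2))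
  then show ?thesis using assms(1) has_fps_expansion_cong by blast
qed

lemma slit_plane_identity:
  assumes "f holomorphic_on slit_plane" "g holomorphic_on slit_plane"
    and "f has_fps_expansion F" "g has_fps_expansion F" "z \<in> slit_plane"
  shows "f z = g z"
proof -
  have "(\<lambda>z. f z - g z) has_fps_expansion 0"
    using has_fps_expansion_diff[OF assms(3,4)] by simp
  from has_fps_expansion_0_analytic_continuation[OF this _ open_slit_plane connected_slit_plane
      zero_in_slit_plane assms(5)] show ?thesis
    using assms(1,2) by (simp add: holomorphic_on_diff)
qed

section \<open>Construction of polylogarithms from their power series\<close>

definition polylog_fps :: "nat list \<Rightarrow> complex fps" where
  "polylog_fps ks = Abs_fps (\<lambda>M. of_real (nested_sum 1 ks M))"

definition is_polylog :: "nat list \<Rightarrow> (complex \<Rightarrow> complex) \<Rightarrow> bool" where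
  "is_polylog ks f \<longleftrightarrow> f holomorphic_on slit_plane \<and> f has_fps_expansion polylog_fps ks"

lemma polylog_fps_Nil: "polylog_fps [] = 1"
  by (simp add: polylog_fps_def nested_sum_Nil fps_eq_iff)

text \<open>The exponent 0 is an auxiliary stage: appending it replaces coefficients by strict
  partial sums, that is, multiplies by z / (1 - z). Each later increment of the exponent is an
  integration against dz / z.\<close>

lemma polylog_fps_snoc_0: "(1 - fps_X) * polylog_fps (ks @ [0]) = fps_X * polylog_fps ks"
proof (rule fps_ext)
  fix n show "((1 - fps_X) * polylog_fps (ks @ [0])) $ n = (fps_X * polylog_fps ks) $ n"
    by (cases n) (simp_all add: polylog_fps_def nested_sum_snoc left_diff_distrib)
qed

lemma polylog_fps_snoc_Suc:
  "fps_X * fps_deriv (polylog_fps (ks @ [Suc k])) = polylog_fps (ks @ [k])"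
proof (rule fps_ext)
  fix n show "(fps_X * fps_deriv (polylog_fps (ks @ [Suc k]))) $ n = polylog_fps (ks @ [k]) $ n"
    by (cases n) (simp_all add: polylog_fps_def nested_sum_snoc del: of_nat_Suc)
qed

text \<open>For \<open>d = 1\<close> the inner sum at \<open>M = 0\<close> is empty. This covers
  \<open>k = 0\<close> as well, where the denominator is 0^0 = 1.\<close>

lemma polylog_fps_snoc_nth_0: "polylog_fps (ks @ [k]) $ 0 = 0"
  by (simp add: polylog_fps_def nested_sum_snoc)

lemma one_notin_slit_plane: "1 \<notin> slit_plane"
  by (simp add: slit_plane_eq)

lemma is_polylog_snoc_0:
  assumes "is_polylog ks f"
  shows "is_polylog (ks @ [0]) (\<lambda>z. z * f z * inverse (1 - z))"
proof -
  have "fps_X * polylog_fps ks * inverse (1 - fps_X) = polylog_fps (ks @ [0])"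
    by (subst polylog_fps_snoc_0[symmetric])
      (simp add: inverse_mult_eq_1' mult.commute mult.left_commute)
  moreover have "(\<lambda>z. z * f z * inverse (1 - z)) has_fps_expansion
      fps_X * polylog_fps ks * inverse (1 - fps_X)"
    using assms unfolding is_polylog_def by (intro fps_expansion_intros) auto
  moreover have "(\<lambda>z. z * f z * inverse (1 - z)) holomorphic_on slit_plane"
    using assms one_notin_slit_plane unfolding is_polylog_def by (auto intro!: holomorphic_intros)
  ultimately show ?thesis by (simp add: is_polylog_def)
qed

text \<open>The wanted function is a primitive of f(z) / z. The singularity at 0 is removable
  because f vanishes there, and a holomorphic function on a starlike domain has a primitive.\<close>

lemma is_polylog_snoc_Suc_exists:
  assumes f: "is_polylog (ks @ [k]) f"
  shows "\<exists>g. is_polylog (ks @ [Suc k]) g"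
proof -
  have f_fps: "f has_fps_expansion polylog_fps (ks @ [k])"
    using f unfolding is_polylog_def by blast
  have f0: "f 0 = 0"
    using has_fps_expansion_imp_0_eq_fps_nth_0[OF f_fps] unfolding polylog_fps_snoc_nth_0 .
  define h where "h = (\<lambda>z. if z = 0 then deriv f 0 else f z / z)"
  have zh: "z * h z = f z" for z by (simp add: h_def f0)
  have h: "h holomorphic_on slit_plane"
  proof (rule pole_theorem_open_0[of f slit_plane 0])
    show "f holomorphic_on slit_plane" using f unfolding is_polylog_def by blast
  qed (simp_all add: open_slit_plane zh f0, simp add: h_def)
  have "h field_differentiable at z" if "z \<in> slit_plane - {}" for z
    using holomorphic_on_imp_differentiable_at[OF h open_slit_plane] that by simp
  from holomorphic_starlike_primitive[OF holomorphic_on_imp_continuous_on[OF h]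
      starlike_slit_plane open_slit_plane finite.emptyI this]
  obtain g where g: "\<And>z. z \<in> slit_plane \<Longrightarrow> (g has_field_derivative h z) (at z)" by blast
  \<comment> \<open>The differential relation leaves the constant coefficient undetermined, so the
    primitive is normalised to vanish at 0.\<close>
  define G where "G = (\<lambda>z. g z - g 0)"
  have G': "(G has_field_derivative h z) (at z)" if "z \<in> slit_plane" for z
    unfolding G_def using g[OF that] by (auto intro!: derivative_eq_intros)
  then have G: "G holomorphic_on slit_plane"
    using open_slit_plane by (auto simp: holomorphic_on_open)
  define E where "E = fps_expansion G 0"
  have E: "G has_fps_expansion E"
    unfolding E_def using G open_slit_plane zero_in_slit_plane
    by (intro has_fps_expansion_fps_expansion)
  have "(\<lambda>z. z * deriv G z) has_fps_expansion fps_X * fps_deriv E"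
    by (intro fps_expansion_intros E)
  then have "f has_fps_expansion fps_X * fps_deriv E"
    by (rule has_fps_expansion_slit_plane_cong) (simp add: DERIV_imp_deriv[OF G'] zh)
  then have eq: "fps_X * fps_deriv E = polylog_fps (ks @ [k])"
    by (rule fps_expansion_unique_complex[OF _ f_fps])
  have "E $ 0 = 0"
    using has_fps_expansion_imp_0_eq_fps_nth_0[OF E] by (simp add: G_def)
  have "E = polylog_fps (ks @ [Suc k])"
  proof (rule fps_ext)
    fix n
    have "(fps_X * fps_deriv E) $ n = (fps_X * fps_deriv (polylog_fps (ks @ [Suc k]))) $ n"
      by (simp add: eq polylog_fps_snoc_Suc)
    with \<open>E $ 0 = 0\<close> show "E $ n = polylog_fps (ks @ [Suc k]) $ n"
      by (cases n) (auto simp: polylog_fps_snoc_nth_0 simp del: of_nat_Suc)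
  qed
  with E G show ?thesis by (auto simp: is_polylog_def)
qed

lemma is_polylog_exists: "\<exists>f. is_polylog ks f"
proof (induction ks rule: rev_induct)
  case Nil
  have "is_polylog [] (\<lambda>_. 1)" by (simp add: is_polylog_def polylog_fps_Nil)
  then show ?case by blast
next
  case (snoc k ks)
  then obtain f where f: "is_polylog ks f" by blast
  show ?case
  proof (induction k)
    case 0
    show ?case using is_polylog_snoc_0[OF f] by blast
  next
    case (Suc k)
    then show ?case using is_polylog_snoc_Suc_exists by blast
  qed
qed

definition polylog :: "nat list \<Rightarrow> complex \<Rightarrow> complex" where
  "polylog ks = (SOME f. is_polylog ks f)"

lemma polylog: "polylog ks holomorphic_on slit_plane" "polylog ks has_fps_expansion polylog_fps ks"
  using someI_ex[OF is_polylog_exists[of ks]] by (simp_all add: polylog_def is_polylog_def)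

lemma polylog_eqI: "is_polylog ks f \<Longrightarrow> z \<in> slit_plane \<Longrightarrow> polylog ks z = f z"
  unfolding is_polylog_def by (elim conjE) (rule slit_plane_identity[OF polylog(1) _ polylog(2)])

lemma polylog_Nil: "z \<in> slit_plane \<Longrightarrow> polylog [] z = 1"
  by (rule polylog_eqI) (simp_all add: is_polylog_def polylog_fps_Nil)

lemma polylog_snoc_at_0: "polylog (ks @ [k]) 0 = 0"
  using has_fps_expansion_imp_0_eq_fps_nth_0[OF polylog(2)] by (simp add: polylog_fps_snoc_nth_0)

text \<open>Functions holomorphic on the connected slit plane with the same expansion at 0 agree, so
  the identity \<open>polylog_fps_snoc_Suc\<close> passes from series to functions.\<close>

lemma polylog_has_derivative:
  assumes "z \<in> slit_plane" "z \<noteq> 0"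
  shows "(polylog (ks @ [Suc k]) has_field_derivative polylog (ks @ [k]) z / z) (at z)"
proof -
  let ?f = "polylog (ks @ [Suc k])"
  have "is_polylog (ks @ [k]) (\<lambda>z. z * deriv ?f z)"
    unfolding is_polylog_def polylog_fps_snoc_Suc[of ks k, symmetric]
    by (intro conjI fps_expansion_intros polylog holomorphic_intros open_slit_plane)
  from polylog_eqI[OF this assms(1)] have "deriv ?f z = polylog (ks @ [k]) z / z"
    using assms(2) by simp
  with holomorphic_derivI[OF polylog(1) open_slit_plane assms(1), of "ks @ [Suc k]"] show ?thesis
    by simp
qed

lemma polylog_snoc_1_has_derivative:
  assumes "z \<in> slit_plane" "z \<noteq> 0"
  shows "(polylog (ks @ [1]) has_field_derivative polylog ks z / (1 - z)) (at z)"
proof -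
  have "is_polylog (ks @ [0]) (\<lambda>z. z * polylog ks z * inverse (1 - z))"
    by (intro is_polylog_snoc_0) (simp add: is_polylog_def polylog)
  from polylog_eqI[OF this assms(1)] have "polylog (ks @ [0]) z / z = polylog ks z / (1 - z)"
    using assms(2) by (simp add: divide_inverse)
  then show ?thesis using polylog_has_derivative[OF assms, of ks 0] by simp
qed

lemma Li_series_eq_polylog:
  assumes "ks \<noteq> []" "\<forall>k\<in>set ks. 1 \<le> k" "norm z < 1"
  shows "Li_series ks z = polylog ks z"
proof -
  have sums: "(\<lambda>M. of_real (nested_sum 1 ks M) * w ^ M) sums polylog ks w" if "norm w < 1" for w
  proof -
    have "eball 0 1 = (ball 0 1 :: complex set)" by (simp add: eball_def ball_def)
    then have "polylog ks holomorphic_on eball 0 1"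
      using holomorphic_on_subset[OF polylog(1) ball_subset_slit_plane] by simp
    from has_fps_expansion_imp_sums_complex[OF polylog(2) this, of w] that show ?thesis
      by (simp add: polylog_fps_def one_ereal_def)
  qed
  \<comment> \<open>At the point |z| the terms are nonnegative, so convergence there is the absolute
    convergence needed at z.\<close>
  have "summable (\<lambda>M. of_real (nested_sum 1 ks M * norm z ^ M) :: complex)"
    using sums[of "of_real (norm z)"] assms(3) by (simp add: sums_iff)
  then have "summable (\<lambda>M. nested_sum 1 ks M * norm z ^ M)"
    by (simp only: summable_complex_of_real)
  then have "summable (\<lambda>M. norm (z ^ M) * nested_sum 1 ks M)"
    by (simp add: norm_power mult.commute)
  from infsum_gap_tuples[OF assms(1,2) _ this]
  have "(\<Sum>\<^sub>\<infinity>ms\<in>gap_tuples 1 (length ks). z ^ last ms * of_real (tuple_weight ks ms)) =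
      (\<Sum>M. z ^ M * of_real (nested_sum 1 ks M))" by simp
  also have "\<dots> = polylog ks z" using sums[OF assms(3)] by (simp add: sums_iff mult.commute)
  finally show ?thesis by (simp add: Li_series_def increasing_tuples_eq tuple_weight_def)
qed

text \<open>\<open>Li\<close> is defined by a Hilbert choice: \<open>polylog\<close> shows that a
  candidate exists, and the identity theorem makes the value independent of the choice.\<close>

lemma Li_eq_polylog:
  assumes "ks \<noteq> []" "\<forall>k\<in>set ks. 1 \<le> k" "z \<in> slit_plane"
  shows "Li ks z = polylog ks z"
proof -
  let ?P = "\<lambda>f. f holomorphic_on slit_plane \<and> (\<forall>z\<in>ball 0 1. f z = Li_series ks z)"
  have eq: "Li_series ks z = polylog ks z" if "z \<in> ball 0 1" for z
    using Li_series_eq_polylog[OF assms(1,2)] that by simp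
  have "?P (polylog ks)" using eq polylog(1) by simp
  then have Li: "?P (Li ks)" using someI[of ?P, folded Li_def] by blast
  have "eventually (\<lambda>z. Li ks z = polylog ks z) (nhds 0)"
    using eventually_nhds_in_open[of "ball 0 1" "0 :: complex"] Li eq
    by (auto elim!: eventually_mono)
  then have "Li ks has_fps_expansion polylog_fps ks"
    using has_fps_expansion_cong polylog(2) by blast
  with Li have "is_polylog ks (Li ks)" by (simp add: is_polylog_def)
  from polylog_eqI[OF this assms(3)] show ?thesis by simp
qed

section \<open>Tail integrals of exponential sums\<close>

text \<open>Up to sign, the density in t of dz / (1 - z) or dz / z along z = 1 - e^(-t) for
  \<open>d = 1\<close> and along z = 1 - e^t for \<open>d = 0\<close>.\<close>

definition letter_weight :: "nat \<Rightarrow> bool \<Rightarrow> real \<Rightarrow> real" where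
  "letter_weight d a t = (if a then 1 else exp (- real d * t) / (1 - exp (- t)))"

lemma letter_weight_nonneg: "0 < t \<Longrightarrow> 0 \<le> letter_weight d a t"
  by (simp add: letter_weight_def)

lemma letter_weight_measurable [measurable]: "letter_weight d a \<in> borel_measurable borel"
  unfolding letter_weight_def by measurable

lemma letter_weight_False_sums:
  assumes "0 < t"
  shows "(\<lambda>n. if d \<le> n then exp (- real n * t) else 0) sums letter_weight d False t"
proof -
  have "(\<lambda>n. exp (- real d * t) * exp (- t) ^ n) sums (exp (- real d * t) * (1 / (1 - exp (- t))))"
    using assms by (intro sums_mult geometric_sums) auto
  then have "(\<lambda>n. if d \<le> n + d then exp (- real (n + d) * t) else 0) sums letter_weight d False t"
    by (simp add: letter_weight_def exp_of_nat_mult[symmetric] exp_add[symmetric] algebra_simps)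
  then show ?thesis
    by (subst (asm) sums_iff_shift) (simp add: sum.neutral)
qed

lemma has_derivative_fps_exp_nth:
  fixes B :: "real fps"
  shows "((\<lambda>t. fps_nth (B * fps_exp t) q) has_real_derivative fps_nth (B * fps_X * fps_exp t) q) (at t)"
proof -
  have "((\<lambda>t. fps_nth (fps_exp t) n) has_real_derivative fps_nth (fps_X * fps_exp t) n) (at t)" for n
  proof (cases n)
    case (Suc k)
    have "((\<lambda>t. t ^ Suc k / fact (Suc k)) has_real_derivative t ^ k / fact k) (at t)"
      by (rule DERIV_cong[OF DERIV_cdivide[OF DERIV_pow]]) (simp del: of_nat_Suc)
    then show ?thesis by (simp add: Suc del: fact_Suc power_Suc)
  qed simp
  then show ?thesis
    unfolding mult.assoc fps_mult_nth[of B] by (intro DERIV_sum DERIV_cmult)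
qed

lemma exp_fps_exp_nth_tendsto_0:
  fixes B :: "real fps"
  assumes "0 < c"
  shows "((\<lambda>t. exp (- c * t) * fps_nth (B * fps_exp t) q) \<longlongrightarrow> 0) at_top"
proof -
  have *: "((\<lambda>t. t ^ n * exp (- c * t)) \<longlongrightarrow> 0) at_top" for n
  proof -
    have "filterlim (\<lambda>t. c * t) at_top at_top"
      using assms by (intro filterlim_tendsto_pos_mult_at_top[OF tendsto_const _ filterlim_ident])
    from filterlim_compose[OF tendsto_power_div_exp_0 this]
    have "((\<lambda>t. (1 / c ^ n) * ((c * t) ^ n / exp (c * t))) \<longlongrightarrow> (1 / c ^ n) * 0) at_top"
      by (intro tendsto_mult tendsto_const) auto
    then show ?thesis using assms by (simp add: power_mult_distrib exp_minus field_simps)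
  qed
  have "((\<lambda>t. \<Sum>i=0..q. fps_nth B i / fact (q - i) * (t ^ (q - i) * exp (- c * t))) \<longlongrightarrow>
      (\<Sum>i=0..q. fps_nth B i / fact (q - i) * 0)) at_top"
    by (intro tendsto_sum tendsto_mult tendsto_const *)
  then show ?thesis
    by (simp add: fps_mult_nth sum_distrib_left mult_ac divide_inverse)
qed

lemma fps_exp_mult_nth_nonneg:
  fixes B :: "real fps"
  assumes "\<And>s. 0 \<le> fps_nth B s" "0 \<le> t"
  shows "0 \<le> fps_nth (B * fps_exp t) q"
  unfolding fps_mult_nth using assms by (intro sum_nonneg mult_nonneg_nonneg) auto

lemma fps_exp_mult_nth_measurable [measurable]:
  "(\<lambda>t. fps_nth (B * fps_exp t :: real fps) q) \<in> borel_measurable borel"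
  unfolding fps_mult_nth fps_exp_nth by measurable

text \<open>Formally, the integral of e^((X - M) u) over u > t is e^((X - M) t) / (M - X), and this
  is exact in each coefficient. For \<open>M = 0\<close> there is no decay, which is why
  \<open>B\<close> must then vanish.\<close>

lemma nn_integral_tail_exp:
  assumes B: "\<And>s. 0 \<le> fps_nth B s" "M = 0 \<Longrightarrow> B = 0" and "0 \<le> t"
  shows "(\<integral>\<^sup>+u. (if t < u then ennreal (exp (- real M * u) * fps_nth (B * fps_exp u) q) else 0) \<partial>lborel)
    = ennreal (exp (- real M * t) * fps_nth (B * geom_fps M * fps_exp t) q)"
proof (cases "M = 0")
  case False
  define C where "C = B * geom_fps M"
  let ?F = "\<lambda>u. - (exp (- real M * u) * fps_nth (C * fps_exp u) q)"
  let ?f = "\<lambda>u. exp (- real M * u) * fps_nth (B * fps_exp u) q"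
  have CB: "C * (fps_const (real M) - fps_X) = B"
    unfolding C_def using geom_fps_inverse[of M] False by (simp add: mult.assoc mult.commute)
  have F': "(?F has_real_derivative ?f u) (at u)" for u
  proof -
    have "C * (fps_const (real M) - fps_X) * fps_exp u =
        fps_const (real M) * (C * fps_exp u) - C * fps_X * fps_exp u"
      by (simp add: algebra_simps)
    then have eq: "fps_nth (B * fps_exp u) q =
        real M * fps_nth (C * fps_exp u) q - fps_nth (C * fps_X * fps_exp u) q"
      unfolding CB by simp
    show ?thesis unfolding eq
      by (auto intro!: derivative_eq_intros has_derivative_fps_exp_nth[of C q u]
          simp: algebra_simps)
  qed
  have "(\<integral>\<^sup>+u. ennreal (?f u) * indicator {t..} u \<partial>lborel) = ennreal (0 - ?F t)"
  proof (rule nn_integral_FTC_atLeast[OF _ F'])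
    show "(?F \<longlongrightarrow> 0) at_top"
      using tendsto_minus[OF exp_fps_exp_nth_tendsto_0[of "real M" C q]] False by simp
  qed (use fps_exp_mult_nth_nonneg[OF B(1)] \<open>0 \<le> t\<close> in auto)
  moreover have "(\<integral>\<^sup>+u. (if t < u then ennreal (?f u) else 0) \<partial>lborel) =
      (\<integral>\<^sup>+u. ennreal (?f u) * indicator {t..} u \<partial>lborel)"
    by (intro nn_integral_cong_AE eventually_mono[OF AE_lborel_singleton[of t]]) auto
  ultimately show ?thesis by (simp add: C_def)
next
  case True
  with B(2) have "B = 0" by simp
  then show ?thesis by (simp cong: if_cong)
qed

lemma suminf_swap_ennreal:
  fixes f :: "nat \<Rightarrow> nat \<Rightarrow> ennreal"
  shows "(\<Sum>i. \<Sum>j. f i j) = (\<Sum>j. \<Sum>i. f i j)"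
proof -
  have "(\<Sum>i. \<Sum>j. f i j) = (\<integral>\<^sup>+i. (\<Sum>j. f i j) \<partial>count_space UNIV)"
    by (rule nn_integral_count_space_nat[symmetric])
  also have "\<dots> = (\<Sum>j. \<integral>\<^sup>+i. f i j \<partial>count_space UNIV)"
    by (rule nn_integral_suminf) simp
  finally show ?thesis by (simp only: nn_integral_count_space_nat)
qed

text \<open>The coefficient of \<open>X\<^bsup>q\<^esup>\<close> in the sum of \<open>A\<^sub>M e\<^bsup>(X - M) t\<^esup>\<close>.\<close>

definition gen_sum :: "(nat \<Rightarrow> real fps) \<Rightarrow> nat \<Rightarrow> real \<Rightarrow> ennreal" where
  "gen_sum A q t = (\<Sum>M. ennreal (exp (- real M * t) * fps_nth (A M * fps_exp t) q))"

lemma gen_sum_measurable [measurable]: "gen_sum A q \<in> borel_measurable borel"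
  unfolding gen_sum_def by measurable

lemma nn_integral_tail_gen_sum:
  assumes B: "\<And>M s. 0 \<le> fps_nth (B M) s" "B 0 = 0" and "0 \<le> t"
  shows "(\<integral>\<^sup>+u. (if t < u then gen_sum B q u else 0) \<partial>lborel) = gen_sum (\<lambda>M. B M * geom_fps M) q t"
proof -
  have "(\<integral>\<^sup>+u. (if t < u then gen_sum B q u else 0) \<partial>lborel) =
    (\<integral>\<^sup>+u. (\<Sum>M. (if t < u then ennreal (exp (- real M * u) * fps_nth (B M * fps_exp u) q) else 0)) \<partial>lborel)"
    by (intro nn_integral_cong) (simp add: gen_sum_def)
  also have "\<dots> = (\<Sum>M. \<integral>\<^sup>+u. (if t < u then ennreal (exp (- real M * u) * fps_nth (B M * fps_exp u) q) else 0) \<partial>lborel)"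
    by (intro nn_integral_suminf) measurable
  also have "\<dots> = gen_sum (\<lambda>M. B M * geom_fps M) q t"
    unfolding gen_sum_def
    by (intro suminf_cong nn_integral_tail_exp assms) (use B(2) in auto)
  finally show ?thesis .
qed

text \<open>Multiplication by e^(-n t) with n at least d moves the term of M' to M = M' + n.
  Regrouping by M leaves exactly the M' with M' + d at most M, the range used in
  \<open>nested_sum\<close>.\<close>

lemma letter_weight_gen_sum:
  assumes A: "\<And>M s. 0 \<le> fps_nth (A M) s" and "0 < t"
  shows "ennreal (letter_weight d a t) * gen_sum A q t =
    gen_sum (if a then A else (\<lambda>M. \<Sum>M'<Suc M - d. A M')) q t"
proof (cases a)
  case False
  let ?x = "\<lambda>M. fps_nth (A M * fps_exp t) q"
  let ?w = "\<lambda>n. if d \<le> n then exp (- real n * t) else 0"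
  have x: "0 \<le> ?x M" for M using fps_exp_mult_nth_nonneg[OF A, of t] \<open>0 < t\<close> by simp
  have w: "ennreal (letter_weight d False t) = (\<Sum>n. ennreal (?w n))"
    using letter_weight_False_sums[OF \<open>0 < t\<close>, of d]
    by (subst suminf_ennreal2) (auto simp: sums_iff)
  have "ennreal (letter_weight d False t) * gen_sum A q t =
    (\<Sum>M'. ennreal (letter_weight d False t) * ennreal (exp (- real M' * t) * ?x M'))"
    unfolding gen_sum_def by simp
  also have "\<dots> = (\<Sum>M'. \<Sum>M. if M' < Suc M - d then ennreal (exp (- real M * t) * ?x M') else 0)"
  proof (intro suminf_cong)
    fix M'
    have "ennreal (letter_weight d False t) * ennreal (exp (- real M' * t) * ?x M') =
        (\<Sum>n. ennreal (?w n) * ennreal (exp (- real M' * t) * ?x M'))"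
      unfolding w by simp
    also have "\<dots> = (\<Sum>n. if M' < Suc (n + M') - d then ennreal (exp (- real (n + M') * t) * ?x M') else 0)"
      by (intro suminf_cong)
        (auto simp: x algebra_simps exp_add[symmetric] simp flip: ennreal_mult)
    also have "\<dots> = (\<Sum>M. if M' < Suc M - d then ennreal (exp (- real M * t) * ?x M') else 0)"
      by (subst suminf_offset[where i = M' and f = "\<lambda>M. if M' < Suc M - d then ennreal (exp (- real M * t) * ?x M') else 0"])
        (auto intro!: sum.neutral)
    finally show "ennreal (letter_weight d False t) * ennreal (exp (- real M' * t) * ?x M') =
      (\<Sum>M. if M' < Suc M - d then ennreal (exp (- real M * t) * ?x M') else 0)" .
  qed
  also have "\<dots> = (\<Sum>M. \<Sum>M'. if M' < Suc M - d then ennreal (exp (- real M * t) * ?x M') else 0)"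
    by (rule suminf_swap_ennreal)
  also have "\<dots> = gen_sum (\<lambda>M. \<Sum>M'<Suc M - d. A M') q t"
    unfolding gen_sum_def
  proof (intro suminf_cong)
    fix M
    have "(\<Sum>M'. if M' < Suc M - d then ennreal (exp (- real M * t) * ?x M') else 0) =
        (\<Sum>M'<Suc M - d. ennreal (exp (- real M * t) * ?x M'))"
      by (subst suminf_finite[of "{..<Suc M - d}"]) auto
    also have "\<dots> = ennreal (exp (- real M * t) * (\<Sum>M'<Suc M - d. ?x M'))"
      using x by (subst sum_ennreal) (auto simp: sum_distrib_left)
    finally show "(\<Sum>M'. if M' < Suc M - d then ennreal (exp (- real M * t) * ?x M') else 0) =
        ennreal (exp (- real M * t) * fps_nth ((\<Sum>M'<Suc M - d. A M') * fps_exp t) q)"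
      by (simp add: sum_distrib_right fps_sum_nth)
  qed
  finally show ?thesis using False by simp
qed (simp add: letter_weight_def)

section \<open>Iterated integrals\<close>

text \<open>Values in \<open>ennreal\<close> make Tonelli available without convergence conditions;
  finiteness comes afterwards, from \<open>represents\<close>.\<close>

definition iter_int :: "nat \<Rightarrow> bool list \<Rightarrow> real \<Rightarrow> ennreal" where
  "iter_int d w = foldl (\<lambda>f a t. \<integral>\<^sup>+u. (if 0 < u \<and> u < t then ennreal (letter_weight d a u) * f u else 0) \<partial>lborel)
    (\<lambda>_. 1) w"

lemma iter_int_Nil [simp]: "iter_int d [] t = 1"
  by (simp add: iter_int_def)

lemma iter_int_snoc:
  "iter_int d (w @ [a]) t =
    (\<integral>\<^sup>+u. (if 0 < u \<and> u < t then ennreal (letter_weight d a u) * iter_int d w u else 0) \<partial>lborel)"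
  by (simp only: iter_int_def foldl_append foldl.simps)

lemma iter_int_measurable [measurable]: "iter_int d w \<in> borel_measurable borel"
proof (induction w rule: rev_induct)
  case Nil
  have "iter_int d [] = (\<lambda>_. 1)" by (simp add: fun_eq_iff)
  then show ?case by simp
next
  case (snoc a w)
  note snoc [measurable]
  have "iter_int d (w @ [a]) = (\<lambda>t. \<integral>\<^sup>+u. (if 0 < u \<and> u < t then ennreal (letter_weight d a u) * iter_int d w u else 0) \<partial>lborel)"
    by (simp add: fun_eq_iff iter_int_snoc)
  then show ?case by simp
qed

lemma index_step_pos:
  assumes "ls \<noteq> []" "1 \<le> last ls"
  shows "index_step ls a \<noteq> []" "1 \<le> last (index_step ls a)"
  by (simp_all add: index_step_def)

lemma nested_fps_index_step:
  assumes "ls \<noteq> []"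
  shows "nested_fps d (index_step ls a) M =
    (if a then nested_fps d ls else (\<lambda>M. \<Sum>M'<Suc M - d. nested_fps d ls M')) M * geom_fps M"
proof (cases a)
  case True
  obtain ls' l where ls: "ls = ls' @ [l]" using assms by (cases ls rule: rev_exhaust) auto
  show ?thesis using True by (simp add: index_step_def ls nested_fps_snoc mult_ac)
next
  case False
  then show ?thesis using nested_fps_snoc[of d ls 1 M] by (simp add: index_step_def)
qed

text \<open>Tonelli moves the outermost letter of \<open>w\<close> from the iterated integral into \<open>g\<close>.\<close>

lemma iter_int_gen_sum:
  assumes "ls \<noteq> []" "1 \<le> last ls" and [measurable]: "g \<in> borel_measurable borel"
    and tail: "\<And>t. 0 \<le> t \<Longrightarrow> (\<integral>\<^sup>+u. (if t < u then g u else 0) \<partial>lborel) = gen_sum (nested_fps d ls) q t"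
  shows "(\<integral>\<^sup>+t. (if 0 < t then g t * iter_int d w t else 0) \<partial>lborel) =
    (\<Sum>M. ennreal (fps_nth (nested_fps d (foldl index_step ls (rev w)) M) q))"
  using assms
proof (induction w arbitrary: ls g rule: rev_induct)
  case Nil
  \<comment> \<open>At \<open>t = 0\<close> the tail is the whole integral and the exponentials are
    1, so the hypothesis on tails is the claim.\<close>
  then show ?case using Nil(4)[of 0] by (simp add: gen_sum_def cong: if_cong)
next
  case (snoc a w)
  note [measurable] = snoc.prems(3)
  let ?g = "\<lambda>u. ennreal (letter_weight d a u) * gen_sum (nested_fps d ls) q u"
  let ?c = "\<lambda>u. ennreal (letter_weight d a u) * iter_int d w u"
  have "(\<integral>\<^sup>+t. (if 0 < t then g t * iter_int d (w @ [a]) t else 0) \<partial>lborel) =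
      (\<integral>\<^sup>+t. \<integral>\<^sup>+u. (if 0 < u \<and> u < t then g t * ?c u else 0) \<partial>lborel \<partial>lborel)"
  proof (intro nn_integral_cong)
    fix t
    show "(if 0 < t then g t * iter_int d (w @ [a]) t else 0) =
      (\<integral>\<^sup>+u. (if 0 < u \<and> u < t then g t * ?c u else 0) \<partial>lborel)"
    proof (cases "0 < t")
      case True
      then show ?thesis unfolding iter_int_snoc
        by (subst nn_integral_cmult[symmetric]) (auto intro!: nn_integral_cong)
    next
      case False
      then have "\<not> (0 < u \<and> u < t)" for u by auto
      then show ?thesis using False by (simp del: de_Morgan_conj)
    qed
  qed
  also have "\<dots> = (\<integral>\<^sup>+u. \<integral>\<^sup>+t. (if 0 < u \<and> u < t then g t * ?c u else 0) \<partial>lborel \<partial>lborel)"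
    by (rule lborel_pair.Fubini') measurable
  \<comment> \<open>For fixed u the t-integral is the tail of \<open>g\<close>, known by hypothesis;
    multiplied by the letter weight it is the new \<open>g\<close> of the induction.\<close>
  also have "\<dots> = (\<integral>\<^sup>+u. (if 0 < u then ?g u * iter_int d w u else 0) \<partial>lborel)"
  proof (intro nn_integral_cong)
    fix u
    show "(\<integral>\<^sup>+t. (if 0 < u \<and> u < t then g t * ?c u else 0) \<partial>lborel) =
      (if 0 < u then ?g u * iter_int d w u else 0)"
    proof (cases "0 < u")
      case True
      have "(\<integral>\<^sup>+t. (if 0 < u \<and> u < t then g t * ?c u else 0) \<partial>lborel) =
          (\<integral>\<^sup>+t. (if u < t then g t else 0) * ?c u \<partial>lborel)"
        using True by (intro nn_integral_cong) auto
      also have "\<dots> = (\<integral>\<^sup>+t. (if u < t then g t else 0) \<partial>lborel) * ?c u"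
        by (rule nn_integral_multc) measurable
      finally show ?thesis using True snoc.prems(4)[of u] by (simp add: mult_ac)
    qed simp
  qed
  also have "\<dots> = (\<Sum>M. ennreal (fps_nth (nested_fps d (foldl index_step (index_step ls a) (rev w)) M) q))"
  proof (rule snoc.IH)
    let ?B = "if a then nested_fps d ls else (\<lambda>M. \<Sum>M'<Suc M - d. nested_fps d ls M')"
    fix t :: real assume t: "0 \<le> t"
    have "(\<integral>\<^sup>+u. (if t < u then ?g u else 0) \<partial>lborel) =
        (\<integral>\<^sup>+u. (if t < u then gen_sum ?B q u else 0) \<partial>lborel)"
      using t by (intro nn_integral_cong) (auto simp: letter_weight_gen_sum nested_fps_nth_nonneg)
    also have "\<dots> = gen_sum (\<lambda>M. ?B M * geom_fps M) q t"
    proof (rule nn_integral_tail_gen_sum[OF _ _ t])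
      show "0 \<le> fps_nth (?B M) s" for M s
        by (auto simp: nested_fps_nth_nonneg fps_sum_nth intro!: sum_nonneg)
      \<comment> \<open>When a new variable opens with \<open>d = 0\<close>, the range at
        \<open>M = 0\<close> is just M' = 0, whose term vanishes because the last exponent is
        positive; for larger \<open>d\<close> the range is empty.\<close>
      show "?B 0 = 0"
        using nested_fps_0[OF snoc.prems(1,2)] by (cases d) auto
    qed
    finally show "(\<integral>\<^sup>+u. (if t < u then ?g u else 0) \<partial>lborel) = gen_sum (nested_fps d (index_step ls a)) q t"
      unfolding nested_fps_index_step[OF snoc.prems(1), abs_def] .
  qed (use index_step_pos[OF snoc.prems(1,2)] in auto)
  finally show ?case by simp
qed

text \<open>Up to sign, the kernel 1 / (e^t - 1) is common to both zeta functions, so its gap is 1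
  even when \<open>d = 0\<close>. From the starting variable 0, both gaps lead to the sum over M at
  least 1, because \<open>geom_fps 0\<close> vanishes.\<close>

lemma initial_weight_tail:
  assumes "d \<le> 1" "0 \<le> t"
  shows "(\<integral>\<^sup>+u. (if t < u then ennreal (letter_weight 1 False u) * ennreal (u ^ q / fact q) else 0) \<partial>lborel)
    = gen_sum (nested_fps d [1]) q t"
proof -
  let ?B = "\<lambda>M. if M = 0 then 0 else 1 :: real fps"
  have "ennreal (letter_weight 1 False u) * ennreal (u ^ q / fact q) = gen_sum ?B q u" if "0 < u" for u
  proof -
    \<comment> \<open>The factor u^q / q! is the coefficient of X^q in e^(u X), encoded by the
      family concentrated at \<open>M = 0\<close>.\<close>
    have "gen_sum (\<lambda>M. if M = 0 then 1 else 0) q u = ennreal (u ^ q / fact q)"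
      unfolding gen_sum_def by (subst suminf_finite[of "{0}"]) auto
    moreover have "(if False then (\<lambda>M. if M = 0 then 1 else 0) else
        (\<lambda>M. \<Sum>M'<Suc M - 1. if M' = 0 then 1 else 0)) = ?B"
      by (auto simp: fun_eq_iff sum.delta)
    ultimately show ?thesis
      using letter_weight_gen_sum[OF _ that, of "\<lambda>M. if M = 0 then 1 else 0" 1 False q] by simp
  qed
  then have "(\<integral>\<^sup>+u. (if t < u then ennreal (letter_weight 1 False u) * ennreal (u ^ q / fact q) else 0) \<partial>lborel)
    = (\<integral>\<^sup>+u. (if t < u then gen_sum ?B q u else 0) \<partial>lborel)"
    using assms by (intro nn_integral_cong) auto
  also have "\<dots> = gen_sum (\<lambda>M. ?B M * geom_fps M) q t"
    by (rule nn_integral_tail_gen_sum) (use assms in auto)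
  also have "(\<lambda>M. ?B M * geom_fps M) = nested_fps d [1]"
  proof
    fix M
    have "(\<Sum>M'<Suc M - d. nested_fps d [] M') = (if d \<le> M then 1 else 0)"
      by (simp add: nested_fps_Nil sum.delta) 
    then show "?B M * geom_fps M = nested_fps d [1] M"
      using nested_fps_snoc[of d "[]" 1 M] assms(1) by (cases M) auto
  qed
  finally show ?thesis .
qed

lemma nn_integral_iter_int:
  assumes "d \<le> 1"
  shows "(\<integral>\<^sup>+t. (if 0 < t then ennreal (letter_weight 1 False t) * ennreal (t ^ q / fact q) * iter_int d w t else 0) \<partial>lborel) =
    (\<Sum>M. ennreal (fps_nth (nested_fps d (foldl index_step [1] (rev w)) M) q))"
  by (rule iter_int_gen_sum) (use initial_weight_tail[OF assms] in auto)

section \<open>The zeta functions as iterated integrals\<close>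

text \<open>The sign of the pullback of dz / (1 - z) along the path; dz / z has positive density in
  both cases.\<close>

definition sgn_gap :: "nat \<Rightarrow> real" where
  "sgn_gap d = (if d = 1 then 1 else - 1)"

definition slit_path :: "nat \<Rightarrow> real \<Rightarrow> real" where
  "slit_path d t = 1 - exp (- sgn_gap d * t)"

lemma sgn_gap_square [simp]: "sgn_gap d * sgn_gap d = 1"
  by (simp add: sgn_gap_def)

lemma slit_path_in_slit_plane: "of_real (slit_path d t) \<in> slit_plane"
  unfolding of_real_in_slit_plane by (simp add: slit_path_def)

lemma slit_path_0 [simp]: "slit_path d 0 = 0"
  by (simp add: slit_path_def)

lemma slit_path_nonzero: "0 < t \<Longrightarrow> slit_path d t \<noteq> 0"
  by (simp add: slit_path_def sgn_gap_def)

lemma slit_path_has_derivative: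
  "(slit_path d has_real_derivative sgn_gap d * (1 - slit_path d t)) (at t)"
  unfolding slit_path_def by (auto intro!: derivative_eq_intros)

lemma letter_weight_False_eq:
  assumes "d \<le> 1" "0 < t"
  shows "sgn_gap d * (1 - slit_path d t) / slit_path d t = letter_weight d False t"
proof -
  consider "d = 0" | "d = 1" using assms(1) by linarith
  then show ?thesis
  proof cases
    case 1
    have "exp t \<noteq> 1" "exp (- t) \<noteq> 1" using assms(2) by auto
    then show ?thesis
      using 1 by (simp add: sgn_gap_def slit_path_def letter_weight_def divide_simps)
        (simp add: algebra_simps flip: exp_add)
  qed (simp add: sgn_gap_def slit_path_def letter_weight_def)
qed

text \<open>With \<open>s\<close> equal to 1 or -1, the function is real of constant sign along the
  path and its absolute value is the iterated integral. The witness \<open>x\<close> also records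
  finiteness.\<close>

definition represents :: "nat \<Rightarrow> (complex \<Rightarrow> complex) \<Rightarrow> bool list \<Rightarrow> real \<Rightarrow> bool" where
  "represents d f w s \<longleftrightarrow> f holomorphic_on slit_plane \<and>
    (\<forall>t>0. \<exists>x\<ge>0. f (of_real (slit_path d t)) = of_real (s * x) \<and> iter_int d w t = ennreal x)"

text \<open>This is the fundamental theorem of calculus along the path, with \<open>c\<close> the
  sign of the pulled-back form. The signs are absorbed into \<open>G\<close>, whose derivative
  \<open>h\<close> is nonnegative.\<close>

lemma represents_step:
  assumes f: "represents d f w s" and s: "s * s = 1" and c: "c * c = 1"
    and F: "F holomorphic_on slit_plane" "F 0 = 0"
    and F': "\<And>t. 0 < t \<Longrightarrow> (F has_field_derivative e t) (at (of_real (slit_path d t)))"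
    and e: "\<And>t. 0 < t \<Longrightarrow> e t * of_real (sgn_gap d * (1 - slit_path d t)) =
      of_real (c * letter_weight d a t) * f (of_real (slit_path d t))"
  shows "represents d F (w @ [a]) (c * s)"
proof -
  define p where "p t = Re (of_real s * f (of_real (slit_path d t)))" for t
  define h where "h t = letter_weight d a t * p t" for t
  define G where "G t = of_real (c * s) * F (of_real (slit_path d t))" for t
  have p: "0 \<le> p t" "f (of_real (slit_path d t)) = of_real (s * p t)" "iter_int d w t = ennreal (p t)"
    if t: "0 < t" for t
  proof -
    obtain x where x: "0 \<le> x" "f (of_real (slit_path d t)) = of_real (s * x)" "iter_int d w t = ennreal x"
      using f t unfolding represents_def by blast
    have "of_real s * f (of_real (slit_path d t)) = of_real (s * s * x)" by (simp add: x(2))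
    then have "p t = x" by (simp add: p_def s)
    with x show "0 \<le> p t" "f (of_real (slit_path d t)) = of_real (s * p t)" "iter_int d w t = ennreal (p t)"
      by auto
  qed
  have path: "((\<lambda>t. of_real (slit_path d t) :: complex) has_vector_derivative
      of_real (sgn_gap d * (1 - slit_path d t))) (at t)" for t
    using slit_path_has_derivative unfolding has_real_derivative_iff_has_vector_derivative
    by (rule bounded_linear.has_vector_derivative[OF bounded_linear_of_real])
  have path_cont: "isCont (\<lambda>t. of_real (slit_path d t) :: complex) t" for t
    using has_vector_derivative_continuous[OF path] by simp
  have hol_cont: "isCont (\<lambda>t. g (of_real (slit_path d t))) t"
    if "g holomorphic_on slit_plane" for g :: "complex \<Rightarrow> complex" and t
  proof -
    have "isCont g (of_real (slit_path d t))"
      using holomorphic_on_imp_continuous_on[OF that] slit_path_in_slit_plane open_slit_plane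
      by (simp add: continuous_on_eq_continuous_at)
    then show ?thesis by (rule isCont_o2[OF path_cont])
  qed
  have f_hol: "f holomorphic_on slit_plane" using f by (simp add: represents_def)
  have G_cont: "isCont G t" for t
    unfolding G_def by (intro continuous_intros hol_cont F(1))
  have G0: "G 0 = 0" by (simp add: G_def F(2))
  have G': "(G has_vector_derivative of_real (h t)) (at t)" if t: "0 < t" for t
  proof -
    have "((\<lambda>t. F (of_real (slit_path d t))) has_vector_derivative
        of_real (sgn_gap d * (1 - slit_path d t)) * e t) (at t)"
      using field_vector_diff_chain_at[OF path F'[OF t]] by (simp add: o_def)
    then have "(G has_vector_derivative
        of_real (c * s) * (of_real (sgn_gap d * (1 - slit_path d t)) * e t)) (at t)"
      unfolding G_def by (rule has_vector_derivative_mult_right)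
    also have "of_real (c * s) * (of_real (sgn_gap d * (1 - slit_path d t)) * e t) =
        of_real ((c * c) * (s * s) * (letter_weight d a t * p t))"
      unfolding mult.commute[of _ "e t"] e[OF t] p(2)[OF t] by (simp add: mult_ac)
    finally show ?thesis by (simp add: c s h_def)
  qed
  have ReG': "((\<lambda>t. Re (G t)) has_real_derivative h t) (at t)" if "0 < t" for t
    using bounded_linear.has_vector_derivative[OF bounded_linear_Re G'[OF that]]
    by (simp add: has_real_derivative_iff_has_vector_derivative)
  have ImG': "((\<lambda>t. Im (G t)) has_real_derivative 0) (at t)" if "0 < t" for t
    using bounded_linear.has_vector_derivative[OF bounded_linear_Im G'[OF that]]
    by (simp add: has_real_derivative_iff_has_vector_derivative)
  \<comment> \<open>The derivative of \<open>G\<close> is real, so its imaginary part is constant on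
    the open half-line; continuity at 0 makes it zero.\<close>
  have "\<exists>k. \<forall>t\<in>{0<..}. Im (G t) = k"
    by (rule has_field_derivative_zero_constant)
      (auto intro: has_field_derivative_at_within ImG')
  then obtain k where k: "Im (G t) = k" if "0 < t" for t by auto
  have G_lim: "(G \<longlongrightarrow> 0) (at_right 0)"
    using G_cont[of 0] unfolding isCont_def G0 by (rule filterlim_mono) (auto simp: at_le)
  have "((\<lambda>t. Im (G t)) \<longlongrightarrow> 0) (at_right 0)"
    using tendsto_Im[OF G_lim] by simp
  then have "((\<lambda>_. k) \<longlongrightarrow> 0) (at_right (0 :: real))"
    by (rule Lim_transform_eventually) (auto simp: eventually_at_filter k)
  then have "k = 0" by (simp add: tendsto_const_iff)
  have h_nonneg: "0 \<le> h t" if "0 < t" for t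
    using p(1)[OF that] letter_weight_nonneg[OF that] by (simp add: h_def)
  have h_cont: "isCont h t" if "0 < t" for t
  proof -
    have "isCont (letter_weight d a) t"
      using that unfolding letter_weight_def by (cases a) (auto intro!: continuous_intros)
    moreover have "isCont p t"
      unfolding p_def by (intro isCont_Re continuous_mult continuous_const hol_cont f_hol)
    ultimately show ?thesis unfolding h_def by (intro continuous_intros)
  qed
  have "\<exists>x\<ge>0. F (of_real (slit_path d t)) = of_real (c * s * x) \<and> iter_int d (w @ [a]) t = ennreal x"
    if t: "0 < t" for t
  proof -
    \<comment> \<open>The weight of dz / z blows up at 0, so only one-sided limits at the endpoints
      are used; nonnegativity of the integrand then yields integrability as well.\<close>
    have A: "(((\<lambda>t. Re (G t)) \<circ> real_of_ereal) \<longlongrightarrow> 0) (at_right 0)"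
      using tendsto_Re[OF G_lim] by (simp add: zero_ereal_def ereal_tendsto_simps1)
    have B: "(((\<lambda>t. Re (G t)) \<circ> real_of_ereal) \<longlongrightarrow> Re (G t)) (at_left (ereal t))"
      unfolding ereal_tendsto_simps1
      using tendsto_Re[OF G_cont[of t, unfolded isCont_def]] by (rule filterlim_mono) (auto simp: at_le)
    have nonneg: "AE x in lborel. 0 < ereal x \<longrightarrow> ereal x < ereal t \<longrightarrow> 0 \<le> h x"
      by (auto simp: h_nonneg)
    note FTC = interval_integral_FTC_nonneg[OF _ _ _ nonneg A B]
    have int: "set_integrable lborel (einterval 0 (ereal t)) h"
      and val: "(LBINT x=0..ereal t. h x) = Re (G t) - 0"
      by (rule FTC; use t ReG' h_cont in simp)+
    have "iter_int d (w @ [a]) t = (\<integral>\<^sup>+u. ennreal (indicator (einterval 0 (ereal t)) u *\<^sub>R h u) \<partial>lborel)"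
      unfolding iter_int_snoc
      by (intro nn_integral_cong)
        (auto simp: einterval_def h_def p letter_weight_nonneg ennreal_mult split: split_indicator)
    also have "\<dots> = ennreal (\<integral>u. indicator (einterval 0 (ereal t)) u *\<^sub>R h u \<partial>lborel)"
      using int unfolding set_integrable_def
      by (intro nn_integral_eq_integral) (auto simp: einterval_def h_nonneg split: split_indicator)
    also have "(\<integral>u. indicator (einterval 0 (ereal t)) u *\<^sub>R h u \<partial>lborel) = Re (G t)"
      using val t by (simp add: interval_lebesgue_integral_le_eq set_lebesgue_integral_def)
    finally have iter: "iter_int d (w @ [a]) t = ennreal (Re (G t))" .
    have "0 \<le> (\<integral>u. indicator (einterval 0 (ereal t)) u *\<^sub>R h u \<partial>lborel)"
      by (intro integral_nonneg_AE) (auto simp: einterval_def h_nonneg split: split_indicator)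
    also have "\<dots> = Re (G t)"
      using val t by (simp add: interval_lebesgue_integral_le_eq set_lebesgue_integral_def)
    finally have "0 \<le> Re (G t)" .
    moreover have "F (of_real (slit_path d t)) = of_real (c * s * Re (G t))"
    proof -
      have "of_real (Re (G t)) = G t" using k[OF t] \<open>k = 0\<close> by (simp add: complex_eq_iff)
      then have "of_real (c * s * Re (G t)) = of_real (c * s) * G t"
        by (simp only: of_real_mult)
      also have "\<dots> = of_real ((c * c) * (s * s)) * F (of_real (slit_path d t))"
        unfolding G_def by (simp add: mult_ac)
      finally show ?thesis by (simp add: c s)
    qed
    ultimately show ?thesis using iter by blast
  qed
  with F(1) show ?thesis by (simp add: represents_def)
qed

text \<open>Only the letter for dz / (1 - z) carries a sign, and it occurs once per entry; hence the
  exponent is the depth.\<close>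

lemma represents_polylog:
  assumes "d \<le> 1" "\<forall>k\<in>set ks. 1 \<le> k"
  shows "represents d (polylog ks) (index_word ks) (sgn_gap d ^ length ks)"
  using assms(2)
proof (induction ks rule: rev_induct)
  case Nil
  have "polylog [] holomorphic_on slit_plane" by (rule polylog)
  then show ?case
    by (auto simp: represents_def polylog_Nil slit_path_in_slit_plane intro!: exI[of _ 1])
next
  case (snoc k ks)
  have pow: "sgn_gap d ^ n * sgn_gap d ^ n = 1" for n
    by (simp flip: power_mult_distrib)
  have "represents d (polylog (ks @ [Suc j])) (index_word ks @ True # replicate j False)
      (sgn_gap d ^ Suc (length ks))" for j
  proof (induction j)
    case 0
    have "represents d (polylog (ks @ [1])) (index_word ks @ [True]) (sgn_gap d * sgn_gap d ^ length ks)"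
    proof (rule represents_step)
      show "represents d (polylog ks) (index_word ks) (sgn_gap d ^ length ks)"
        using snoc by simp
      show "(polylog (ks @ [1]) has_field_derivative
          polylog ks (of_real (slit_path d t)) / (1 - of_real (slit_path d t))) (at (of_real (slit_path d t)))"
        if "0 < t" for t
        using slit_path_in_slit_plane slit_path_nonzero[OF that]
        by (intro polylog_snoc_1_has_derivative) auto
      fix t :: real
      have "1 - slit_path d t \<noteq> 0" by (simp add: slit_path_def)
      then have "1 - of_real (slit_path d t) \<noteq> (0 :: complex)"
        by (metis of_real_1 of_real_diff of_real_eq_0_iff)
      then show "polylog ks (of_real (slit_path d t)) / (1 - of_real (slit_path d t)) *
          of_real (sgn_gap d * (1 - slit_path d t)) =
        of_real (sgn_gap d * letter_weight d True t) * polylog ks (of_real (slit_path d t))"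
        by (simp add: letter_weight_def)
    qed (simp_all add: pow polylog polylog_snoc_at_0[of ks "Suc 0"])
    then show ?case by simp
  next
    case (Suc j)
    have "represents d (polylog (ks @ [Suc (Suc j)])) ((index_word ks @ True # replicate j False) @ [False])
        (1 * sgn_gap d ^ Suc (length ks))"
    proof (rule represents_step[OF Suc pow])
      show "(polylog (ks @ [Suc (Suc j)]) has_field_derivative
          polylog (ks @ [Suc j]) (of_real (slit_path d t)) / of_real (slit_path d t))
          (at (of_real (slit_path d t)))"
        if "0 < t" for t
        using slit_path_in_slit_plane slit_path_nonzero[OF that]
        by (intro polylog_has_derivative) auto
      fix t :: real assume "0 < t"
      show "polylog (ks @ [Suc j]) (of_real (slit_path d t)) / of_real (slit_path d t) *
          of_real (sgn_gap d * (1 - slit_path d t)) =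
        of_real (1 * letter_weight d False t) * polylog (ks @ [Suc j]) (of_real (slit_path d t))"
        unfolding letter_weight_False_eq[OF assms(1) \<open>0 < t\<close>, symmetric] by simp
    qed (simp_all add: polylog polylog_snoc_at_0)
    then show ?case by (simp add: replicate_append_same)
  qed
  from this[of "k - 1"] snoc.prems show ?case by simp
qed

text \<open>The constant \<open>c\<close> holds the factorial that cancels Gamma and, for eta, the
  sign of the kernel.\<close>

lemma zeta_integral:
  fixes f :: "real \<Rightarrow> complex" and c :: real
  assumes d: "d \<le> 1" and ks: "ks \<noteq> []" "\<forall>k\<in>set ks. 1 \<le> k"
    and f: "\<And>t. 0 < t \<Longrightarrow> f t = of_real (c * (letter_weight 1 False t * (t ^ q / fact q))) *
      Li ks (of_real (slit_path d t))"
  defines "ls \<equiv> dual_index (index_plus ks)"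
  shows "(LINT t:{0<..}|lborel. f t) = of_real (c * sgn_gap d ^ length ks *
    (\<Sum>js\<in>weak_compositions (length ls) q. real (b_coeff ls js) * (\<Sum>M. nested_sum d (index_add ls js) M)))"
proof -
  define S where "S = (\<Sum>js\<in>weak_compositions (length ls) q. real (b_coeff ls js) * (\<Sum>M. nested_sum d (index_add ls js) M))"
  define h where "h t = (if 0 < t then letter_weight 1 False t * (t ^ q / fact q) *
    enn2real (iter_int d (index_word ks) t) else 0)" for t
  note dual = dual_index_plus[OF ks, folded ls_def]
  have h_meas: "h \<in> borel_measurable lborel" unfolding h_def by measurable
  have h_nonneg: "0 \<le> h t" for t
    by (simp add: h_def letter_weight_nonneg)
  have rep: "\<exists>x\<ge>0. Li ks (of_real (slit_path d t)) = of_real (sgn_gap d ^ length ks * x) \<and>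
      iter_int d (index_word ks) t = ennreal x" if "0 < t" for t
    using represents_polylog[OF d ks(2)] that Li_eq_polylog[OF ks slit_path_in_slit_plane]
    by (simp add: represents_def)
  have f_h: "indicator {0<..} t *\<^sub>R f t = of_real (c * sgn_gap d ^ length ks * h t)" for t
  proof (cases "0 < t")
    case True
    with rep obtain x where "0 \<le> x" "Li ks (of_real (slit_path d t)) = of_real (sgn_gap d ^ length ks * x)"
      "iter_int d (index_word ks) t = ennreal x" by blast
    with True show ?thesis by (simp add: f h_def mult_ac)
  qed (simp add: h_def)
  have sums: "(\<lambda>M. fps_nth (nested_fps d ls M) q) sums S"
    unfolding S_def by (rule nested_fps_index_sum(1)[OF dual(3,2,4)])
  then have S: "S = (\<Sum>M. fps_nth (nested_fps d ls M) q)" by (simp add: sums_iff)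
  have "(\<integral>\<^sup>+t. ennreal (h t) \<partial>lborel) =
    (\<integral>\<^sup>+t. (if 0 < t then ennreal (letter_weight 1 False t) * ennreal (t ^ q / fact q) *
      iter_int d (index_word ks) t else 0) \<partial>lborel)"
  proof (intro nn_integral_cong)
    fix t
    show "ennreal (h t) = (if 0 < t then ennreal (letter_weight 1 False t) * ennreal (t ^ q / fact q) *
      iter_int d (index_word ks) t else 0)"
    proof (cases "0 < t")
      case True
      with rep obtain x where "0 \<le> x" "iter_int d (index_word ks) t = ennreal x" by blast
      with True letter_weight_nonneg[OF True] show ?thesis
        by (simp add: h_def flip: ennreal_mult)
    qed (simp add: h_def)
  qed
  also have "\<dots> = (\<Sum>M. ennreal (fps_nth (nested_fps d ls M) q))"
    unfolding nn_integral_iter_int[OF d] dual(1) ..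
  also have "\<dots> = ennreal S"
    unfolding S using sums by (intro suminf_ennreal2) (auto simp: nested_fps_nth_nonneg sums_iff)
  \<comment> \<open>A nonnegative measurable function with finite integral is Bochner integrable,
    which carries the value from \<open>ennreal\<close> to the original integral.\<close>
  finally have "has_bochner_integral lborel h S"
    using h_meas h_nonneg S sums suminf_nonneg[of "\<lambda>M. fps_nth (nested_fps d ls M) q"]
    by (intro has_bochner_integral_nn_integral) (auto simp: nested_fps_nth_nonneg sums_iff)
  then have "(\<integral>t. h t \<partial>lborel) = S" by (rule has_bochner_integral_integral_eq)
  then show ?thesis
    unfolding set_lebesgue_integral_def f_h S_def[symmetric] by simp
qed

section \<open>Values of xi and eta at positive integers\<close>

lemma of_real_powr_minus_1:
  assumes "0 < t"
  shows "of_real t powr (of_nat (Suc q) - 1) = (of_real (t ^ q) :: complex)"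
  using assms by (simp add: powr_nat')

lemma letter_weight_1_False: "0 < t \<Longrightarrow> letter_weight 1 False t = 1 / (exp t - 1)"
  by (simp add: letter_weight_def exp_minus divide_simps)

lemma AK_xi_Suc:
  assumes "ks \<noteq> []" "\<forall>k\<in>set ks. 1 \<le> k" "ls = dual_index (index_plus ks)"
  shows "AK_xi ks (of_nat (Suc q)) =
    of_real (\<Sum>js\<in>weak_compositions (length ls) q. real (b_coeff ls js) * mzv (index_add ls js))"
proof -
  have "of_real t powr (of_nat (Suc q) - 1) * (Li ks (of_real (1 - exp (- t))) / of_real (exp t - 1)) =
      of_real (fact q * (letter_weight 1 False t * (t ^ q / fact q))) * Li ks (of_real (slit_path 1 t))"
    if "0 < t" for t
    unfolding of_real_powr_minus_1[OF that] letter_weight_1_False[OF that]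
    by (simp add: slit_path_def sgn_gap_def)
  from zeta_integral[OF _ assms(1,2) this]
  have "AK_xi ks (of_nat (Suc q)) = of_real
    (\<Sum>js\<in>weak_compositions (length ls) q. real (b_coeff ls js) * (\<Sum>M. nested_sum 1 (index_add ls js) M))"
    unfolding AK_xi_def assms(3) using Gamma_fact[of q, where 'a = complex] by (simp add: sgn_gap_def)
  also have "(\<Sum>js\<in>weak_compositions (length ls) q. real (b_coeff ls js) * (\<Sum>M. nested_sum 1 (index_add ls js) M)) =
      (\<Sum>js\<in>weak_compositions (length ls) q. real (b_coeff ls js) * mzv (index_add ls js))"
    using nested_fps_index_sum(2)[OF dual_index_plus(3,2,4)[OF assms(1,2), folded assms(3)]]
    by (intro sum.cong refl) (simp add: mzv_eq(1))
  finally show ?thesis .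
qed

lemma KT_eta_Suc:
  assumes "ks \<noteq> []" "\<forall>k\<in>set ks. 1 \<le> k" "ls = dual_index (index_plus ks)"
  shows "KT_eta ks (of_nat (Suc q)) = of_real ((- 1) ^ (length ks - 1) *
    (\<Sum>js\<in>weak_compositions (length ls) q. real (b_coeff ls js) * mzv_star (index_add ls js)))"
proof -
  have "of_real t powr (of_nat (Suc q) - 1) * (Li ks (of_real (1 - exp t)) / of_real (1 - exp t)) =
      of_real (- fact q * (letter_weight 1 False t * (t ^ q / fact q))) * Li ks (of_real (slit_path 0 t))"
    if "0 < t" for t
  proof -
    have "1 / (1 - exp t) = - (1 / (exp t - 1))" using that by (simp add: divide_simps)
    then have "(of_real (1 / (1 - exp t)) :: complex) = of_real (- (1 / (exp t - 1)))" by simp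
    then show ?thesis
      unfolding of_real_powr_minus_1[OF that] letter_weight_1_False[OF that]
      by (simp add: slit_path_def sgn_gap_def divide_inverse)
  qed
  from zeta_integral[OF _ assms(1,2) this]
  have "KT_eta ks (of_nat (Suc q)) = of_real (- ((- 1) ^ length ks) *
    (\<Sum>js\<in>weak_compositions (length ls) q. real (b_coeff ls js) * (\<Sum>M. nested_sum 0 (index_add ls js) M)))"
    unfolding KT_eta_def assms(3) using Gamma_fact[of q, where 'a = complex] by (simp add: sgn_gap_def)
  also have "(\<Sum>js\<in>weak_compositions (length ls) q. real (b_coeff ls js) * (\<Sum>M. nested_sum 0 (index_add ls js) M)) =
      (\<Sum>js\<in>weak_compositions (length ls) q. real (b_coeff ls js) * mzv_star (index_add ls js))"
    using nested_fps_index_sum(2)[OF dual_index_plus(3,2,4)[OF assms(1,2), folded assms(3)]]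
    by (intro sum.cong refl) (simp add: mzv_eq(2))
  \<comment> \<open>The sign of the kernel cancels one of the r signs of the polylogarithm; r is
    positive, so the subtraction is not truncated.\<close>
  also have "- ((- 1) ^ length ks) = ((- 1) ^ (length ks - 1) :: real)"
    using assms(1) by (cases ks) simp_all
  finally show ?thesis .
qed

lemma sum_weak_compositions_0:
  "(\<Sum>js\<in>weak_compositions (length ls) 0. real (b_coeff ls js) * g (index_add ls js)) = g ls"
proof -
  have "weak_compositions (length ls) 0 = {replicate (length ls) 0}"
    by (auto simp: weak_compositions_def intro!: replicate_eqI)
  moreover have "index_add ls (replicate (length ls) 0) = ls"
    by (simp add: index_add_def list_eq_iff_nth_eq)
  ultimately show ?thesis by (simp add: b_coeff_def)
qed

theorem theorem2p5:
  fixes ks ls :: "nat list" and r m n :: nat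
  assumes "length ks = r" and "r \<ge> 1" and "\<forall>k\<in>set ks. k \<ge> 1" and "m \<ge> 1"
    and "ls = dual_index (index_plus ks)" and "n = length ls"
  shows "n = sum_list ks + 1 - r
    \<and> AK_xi ks (of_nat m) =
        of_real (\<Sum>js\<in>weak_compositions n (m - 1). real (b_coeff ls js) * mzv (index_add ls js))
    \<and> KT_eta ks (of_nat m) =
        of_real ((- 1) ^ (r - 1) *
          (\<Sum>js\<in>weak_compositions n (m - 1). real (b_coeff ls js) * mzv_star (index_add ls js)))
    \<and> AK_xi ks 1 = of_real (mzv ls)
    \<and> KT_eta ks 1 = of_real ((- 1) ^ (r - 1) * mzv_star ls)"
proof -
  have ks: "ks \<noteq> []" "\<forall>k\<in>set ks. 1 \<le> k" using assms by auto
  obtain q where q: "m = Suc q" using assms(4) by (cases m) auto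
  show ?thesis
    using dual_index_plus(5)[OF ks, folded assms(5)]
      AK_xi_Suc[OF ks assms(5), of q] KT_eta_Suc[OF ks assms(5), of q]
      AK_xi_Suc[OF ks assms(5), of 0, unfolded sum_weak_compositions_0[of ls mzv]]
      KT_eta_Suc[OF ks assms(5), of 0, unfolded sum_weak_compositions_0[of ls mzv_star]]
    by (simp add: q assms(1,6))
qed

end
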